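(* Let $G$ be a finite abelian group of exponent $e$, and let $R$ be a commutative ring with unit equipped with a ring homomorphism $\mathbb{Z}[\zeta_e]\to R$ ($\zeta_e$ a primitive complex $e$-th root of unity). Let $M$ be a finite $R[G]$-module. Suppose $G=K_1\times\cdots\times K_r$ ($r\ge 1$) with each $K_i$ cyclic, and for $0\le i\le r-1$ set $G_i=K_1\times\cdots\times K_i$, with $G_0$ the trivial group. Then $$[M]\cdot\prod_{i=1}^{r}\ \prod_{\chi_i\in\widehat{K}_i}\ \prod_{\psi\in\widehat{G}_{i-1}}\Big[\widehat{H}^0_{\chi_i}(K_i,M^{\psi})/S_{\chi_i}(M^{\psi})\Big]=\prod_{\chi\in\widehat{G}}[M^{\chi}].$$
   Context: $[X]$ denotes the order of a finite set $X$. For a subgroup $\Gamma$ of $G$, $\widehat{\Gamma}$ denotes the set of homomorphisms $\Gamma\to\mu_e\subset\mathbb{Z}[\zeta_e]^{\times}$, each regarded as an $R$-valued character via the fixed homomorphism $\mathbb{Z}[\zeta_e]\to R$; products over $\widehat\Gamma$ are indexed by these $|\Gamma|$ characters. For a $R[\Gamma]$-module $N$ and $\chi\in\widehat\Gamma$: $N^{\chi}=\{m\in N:\ \sigma m=\chi(\sigma)m\ \forall\sigma\in\Gamma\}$, $\varepsilon_\chi=\sum_{\sigma\in\Gamma}\chi(\sigma)^{-1}\sigma\in R[\Gamma]$, and $\widehat H^0_\chi(\Gamma,N)=N^\chi/\varepsilon_\chi N$. For $\psi\in\widehat{G}_{i-1}$, $M^{\psi}$ (isotypic part for the $G_{i-1}$-action)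 is a $G$-stable submodule since $G$ is abelian, and is regarded as an $R[K_i]$-module. For each $i$ fix a generator $\tau_i$ of $K_i$ (order $m_i$), let $\zeta_{m_i}=\zeta_e^{e/m_i}$ (image in $R$), let $\xi_i\in\widehat K_i$ be the character with $\xi_i(\tau_i)=\zeta_{m_i}$, so $\widehat K_i=\{\xi_i^k:0\le k\le m_i-1\}$. For a finite $R[K_i]$-module $N$ and $0\le k\le m_i-1$, define $S_{\xi_i^k}(N)=\big(N^{\xi_i^k}\cap\prod_{j=k+1}^{m_i-1}(\tau_i-\zeta_{m_i}^j)N\big)/\varepsilon_{\xi_i^k}N$ (empty product $=1$), a submodule of $\widehat H^0_{\xi_i^k}(K_i,N)$. *)

theory Defs
  imports Complex_Main "HOL-Algebra.Algebra" "HOL-Algebra.Algebraic_Closure_Type"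
begin

subsection \<open>Exponents, roots of unity and characters\<close>

definition group_exponent :: "('g, 'x) monoid_scheme \<Rightarrow> nat" where
  "group_exponent G = (LEAST n. n > 0 \<and> (\<forall>x\<in>carrier G. x [^]\<^bsub>G\<^esub> n = \<one>\<^bsub>G\<^esub>))"

definition primitive_root_of_unity :: "nat \<Rightarrow> complex \<Rightarrow> bool" where
  "primitive_root_of_unity e \<zeta> \<longleftrightarrow> e > 0 \<and> \<zeta> ^ e = 1 \<and> (\<forall>k. 0 < k \<and> k < e \<longrightarrow> \<zeta> ^ k \<noteq> 1)"

text \<open>The ring \<open>\<int>[\<zeta>]\<close>, as the subring of the complex numbers generated by \<open>\<zeta>\<close>.\<close>

definition int_adjoin :: "complex \<Rightarrow> complex ring" where
  "int_adjoin \<zeta> = ring_of_type_algebra\<lparr>carrier := generate_ring ring_of_type_algebra {\<zeta>}\<rparr>"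

definition roots_of_unity :: "nat \<Rightarrow> complex monoid" where
  "roots_of_unity e = \<lparr>carrier = {z. z ^ e = 1}, monoid.mult = (*), one = 1\<rparr>"

text \<open>Homomorphisms are only specified on the carrier, so each one is represented by its
  extensional representative; otherwise the products over characters would be over infinite sets.\<close>

definition characters :: "nat \<Rightarrow> ('g, 'x) monoid_scheme \<Rightarrow> ('g \<Rightarrow> complex) set" where
  "characters e \<Gamma> = hom \<Gamma> (roots_of_unity e) \<inter> extensional (carrier \<Gamma>)"


subsection \<open>Group rings of finite groups and their modules\<close>

definition group_ring :: "('r, 'y) ring_scheme \<Rightarrow> ('g, 'x) monoid_scheme \<Rightarrow> ('g \<Rightarrow> 'r) ring" where
  "group_ring R \<Gamma> = \<lparr>
     carrier = carrier \<Gamma> \<rightarrow>\<^sub>E carrier R,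
     monoid.mult = (\<lambda>a b. \<lambda>\<sigma>\<in>carrier \<Gamma>.
       \<Oplus>\<^bsub>R\<^esub>\<rho>\<in>carrier \<Gamma>. a \<rho> \<otimes>\<^bsub>R\<^esub> b (inv\<^bsub>\<Gamma>\<^esub> \<rho> \<otimes>\<^bsub>\<Gamma>\<^esub> \<sigma>)),
     one = (\<lambda>\<sigma>\<in>carrier \<Gamma>. if \<sigma> = \<one>\<^bsub>\<Gamma>\<^esub> then \<one>\<^bsub>R\<^esub> else \<zero>\<^bsub>R\<^esub>),
     ring.zero = (\<lambda>\<sigma>\<in>carrier \<Gamma>. \<zero>\<^bsub>R\<^esub>),
     add = (\<lambda>a b. \<lambda>\<sigma>\<in>carrier \<Gamma>. a \<sigma> \<oplus>\<^bsub>R\<^esub> b \<sigma>)\<rparr>"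

text \<open>The library's notion of a module presupposes that the ring of scalars is a \<open>cring\<close>, which
  \<open>R[\<Gamma>]\<close> is for finite commutative \<open>\<Gamma>\<close>.\<close>

lemma (in abelian_monoid) finsum_swap:
  assumes "finite A" "finite B" "\<And>x y. x \<in> A \<Longrightarrow> y \<in> B \<Longrightarrow> f x y \<in> carrier G"
  shows "(\<Oplus>x\<in>A. \<Oplus>y\<in>B. f x y) = (\<Oplus>y\<in>B. \<Oplus>x\<in>A. f x y)"
  using assms(1,3)
proof (induction A rule: finite_induct)
  case empty
  then show ?case using finsum_zero by simp
next
  case (insert a A)
  have "(\<Oplus>x\<in>insert a A. \<Oplus>y\<in>B. f x y) = (\<Oplus>y\<in>B. f a y) \<oplus> (\<Oplus>x\<in>A. \<Oplus>y\<in>B. f x y)"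
    using insert.hyps insert.prems by (intro finsum_insert) (auto intro!: finsum_closed)
  also have "\<dots> = (\<Oplus>y\<in>B. f a y) \<oplus> (\<Oplus>y\<in>B. \<Oplus>x\<in>A. f x y)"
    using insert by simp
  also have "\<dots> = (\<Oplus>y\<in>B. f a y \<oplus> (\<Oplus>x\<in>A. f x y))"
    using insert.prems by (intro finsum_addf[symmetric]) (auto intro!: finsum_closed)
  also have "\<dots> = (\<Oplus>y\<in>B. \<Oplus>x\<in>insert a A. f x y)"
    using insert.hyps insert.prems
    by (intro finsum_cong') (auto intro!: finsum_closed finsum_insert[symmetric])
  finally show ?case .
qed

lemma cring_group_ring:
  assumes "comm_group \<Gamma>" "finite (carrier \<Gamma>)" "cring R"
  shows "cring (group_ring R \<Gamma>)"
proof -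
  interpret G: comm_group \<Gamma> by fact
  interpret R: cring R by fact
  let ?S = "group_ring R \<Gamma>"
  have fin: "finite (carrier \<Gamma>)" by fact
  have ev: "a \<sigma> \<in> carrier R" if "a \<in> carrier ?S" "\<sigma> \<in> carrier \<Gamma>" for a \<sigma>
    using that by (auto simp: group_ring_def)
  have eqI: "a = b" if "a \<in> carrier ?S" "b \<in> carrier ?S"
      "\<And>\<sigma>. \<sigma> \<in> carrier \<Gamma> \<Longrightarrow> a \<sigma> = b \<sigma>" for a b
    using that by (auto simp: group_ring_def intro: PiE_ext)
  have mult_closed: "a \<otimes>\<^bsub>?S\<^esub> b \<in> carrier ?S" if "a \<in> carrier ?S" "b \<in> carrier ?S" for a b
    using that by (auto simp: group_ring_def intro!: R.finsum_closed R.m_closed)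
  have add_closed: "a \<oplus>\<^bsub>?S\<^esub> b \<in> carrier ?S" if "a \<in> carrier ?S" "b \<in> carrier ?S" for a b
    using that by (auto simp: group_ring_def)
  have mult: "(a \<otimes>\<^bsub>?S\<^esub> b) \<sigma> = (\<Oplus>\<^bsub>R\<^esub>\<rho>\<in>carrier \<Gamma>. a \<rho> \<otimes>\<^bsub>R\<^esub> b (inv\<^bsub>\<Gamma>\<^esub> \<rho> \<otimes>\<^bsub>\<Gamma>\<^esub> \<sigma>))"
    if "\<sigma> \<in> carrier \<Gamma>" for a b \<sigma> using that by (simp add: group_ring_def)
  have add: "(a \<oplus>\<^bsub>?S\<^esub> b) \<sigma> = a \<sigma> \<oplus>\<^bsub>R\<^esub> b \<sigma>" if "\<sigma> \<in> carrier \<Gamma>" for a b \<sigma>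
    using that by (simp add: group_ring_def)
  have one: "\<one>\<^bsub>?S\<^esub> \<in> carrier ?S" and zero: "\<zero>\<^bsub>?S\<^esub> \<in> carrier ?S"
    by (auto simp: group_ring_def)
  show ?thesis
  proof (rule cringI)
    show "abelian_group ?S"
    proof (rule abelian_groupI)
      fix x assume x: "x \<in> carrier ?S"
      show "\<exists>y\<in>carrier ?S. y \<oplus>\<^bsub>?S\<^esub> x = \<zero>\<^bsub>?S\<^esub>"
        using x by (intro bexI[of _ "\<lambda>\<sigma>\<in>carrier \<Gamma>. \<ominus>\<^bsub>R\<^esub> x \<sigma>"])
          (auto simp: group_ring_def intro!: ext R.l_neg)
      show "\<zero>\<^bsub>?S\<^esub> \<oplus>\<^bsub>?S\<^esub> x = x"
        using x by (intro eqI add_closed zero) (auto simp: add ev, auto simp: group_ring_def intro!: R.l_zero)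
    next
      fix x y z assume "x \<in> carrier ?S" "y \<in> carrier ?S" "z \<in> carrier ?S"
      then show "x \<oplus>\<^bsub>?S\<^esub> y \<oplus>\<^bsub>?S\<^esub> z = x \<oplus>\<^bsub>?S\<^esub> (y \<oplus>\<^bsub>?S\<^esub> z)"
        by (intro eqI add_closed) (simp_all add: add ev R.a_assoc)
    next
      fix x y assume "x \<in> carrier ?S" "y \<in> carrier ?S"
      then show "x \<oplus>\<^bsub>?S\<^esub> y = y \<oplus>\<^bsub>?S\<^esub> x"
        by (intro eqI add_closed) (simp_all add: add ev R.a_comm)
    qed (auto intro: add_closed zero)
    show "comm_monoid ?S"
    proof (rule comm_monoidI)
      fix x y z assume x: "x \<in> carrier ?S" and y: "y \<in> carrier ?S" and z: "z \<in> carrier ?S"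
      show "x \<otimes>\<^bsub>?S\<^esub> y = y \<otimes>\<^bsub>?S\<^esub> x"
      proof (intro eqI mult_closed x y)
        fix \<sigma> assume s: "\<sigma> \<in> carrier \<Gamma>"
        let ?h = "\<lambda>\<rho>. inv\<^bsub>\<Gamma>\<^esub> \<rho> \<otimes>\<^bsub>\<Gamma>\<^esub> \<sigma>"
        have inj: "inj_on ?h (carrier \<Gamma>)"
          using s by (auto intro!: inj_onI dest: G.inv_inj[THEN inj_onD])
        have hh: "?h (?h \<rho>) = \<rho>" if "\<rho> \<in> carrier \<Gamma>" for \<rho>
        proof -
          have "?h (?h \<rho>) = inv\<^bsub>\<Gamma>\<^esub> \<sigma> \<otimes>\<^bsub>\<Gamma>\<^esub> \<rho> \<otimes>\<^bsub>\<Gamma>\<^esub> \<sigma>"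
            using that s by (simp add: G.inv_mult_group)
          also have "\<dots> = \<rho> \<otimes>\<^bsub>\<Gamma>\<^esub> inv\<^bsub>\<Gamma>\<^esub> \<sigma> \<otimes>\<^bsub>\<Gamma>\<^esub> \<sigma>"
            using that s by (simp add: G.m_comm)
          also have "\<dots> = \<rho>" using that s by (simp add: G.m_assoc)
          finally show ?thesis .
        qed
        have img: "?h ` carrier \<Gamma> = carrier \<Gamma>"
        proof
          show "carrier \<Gamma> \<subseteq> ?h ` carrier \<Gamma>"
          proof
            fix \<rho> assume "\<rho> \<in> carrier \<Gamma>"
            then show "\<rho> \<in> ?h ` carrier \<Gamma>"
              using s by (intro image_eqI[where x = "?h \<rho>"]) (simp_all add: hh)
          qed
        qed (use s in auto)
        have "(x \<otimes>\<^bsub>?S\<^esub> y) \<sigma> = (\<Oplus>\<^bsub>R\<^esub>\<rho>\<in>?h ` carrier \<Gamma>. x \<rho> \<otimes>\<^bsub>R\<^esub> y (?h \<rho>))"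
          using s by (simp add: mult img)
        also have "\<dots> = (\<Oplus>\<^bsub>R\<^esub>\<rho>\<in>carrier \<Gamma>. x (?h \<rho>) \<otimes>\<^bsub>R\<^esub> y (?h (?h \<rho>)))"
          using x y s by (intro R.finsum_reindex inj) (auto intro!: R.m_closed ev[OF x] ev[OF y] ev[OF z])
        also have "\<dots> = (\<Oplus>\<^bsub>R\<^esub>\<rho>\<in>carrier \<Gamma>. y \<rho> \<otimes>\<^bsub>R\<^esub> x (?h \<rho>))"
          using x y s by (intro R.finsum_cong') (auto simp: hh intro!: R.m_comm R.m_closed ev[OF x] ev[OF y] ev[OF z])
        finally show "(x \<otimes>\<^bsub>?S\<^esub> y) \<sigma> = (y \<otimes>\<^bsub>?S\<^esub> x) \<sigma>" using s by (simp add: mult)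
      qed
      show "x \<otimes>\<^bsub>?S\<^esub> y \<otimes>\<^bsub>?S\<^esub> z = x \<otimes>\<^bsub>?S\<^esub> (y \<otimes>\<^bsub>?S\<^esub> z)"
      proof (intro eqI mult_closed x y z)
        fix \<sigma> assume s: "\<sigma> \<in> carrier \<Gamma>"
        let ?C = "carrier \<Gamma>"
        have "(x \<otimes>\<^bsub>?S\<^esub> y \<otimes>\<^bsub>?S\<^esub> z) \<sigma> =
          (\<Oplus>\<^bsub>R\<^esub>\<tau>\<in>?C. (\<Oplus>\<^bsub>R\<^esub>\<rho>\<in>?C. x \<rho> \<otimes>\<^bsub>R\<^esub> y (inv\<^bsub>\<Gamma>\<^esub> \<rho> \<otimes>\<^bsub>\<Gamma>\<^esub> \<tau>)) \<otimes>\<^bsub>R\<^esub> z (inv\<^bsub>\<Gamma>\<^esub> \<tau> \<otimes>\<^bsub>\<Gamma>\<^esub> \<sigma>))"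
          using s x y z
          by (subst mult, simp) (auto intro!: R.finsum_cong' R.m_closed R.finsum_closed ev[OF x] ev[OF y] ev[OF z] simp: mult)
        also have "\<dots> = (\<Oplus>\<^bsub>R\<^esub>\<tau>\<in>?C. \<Oplus>\<^bsub>R\<^esub>\<rho>\<in>?C. x \<rho> \<otimes>\<^bsub>R\<^esub> y (inv\<^bsub>\<Gamma>\<^esub> \<rho> \<otimes>\<^bsub>\<Gamma>\<^esub> \<tau>) \<otimes>\<^bsub>R\<^esub> z (inv\<^bsub>\<Gamma>\<^esub> \<tau> \<otimes>\<^bsub>\<Gamma>\<^esub> \<sigma>))"
          using s x y z fin
          by (intro R.finsum_cong') (auto intro!: R.m_closed R.finsum_closed ev[OF x] ev[OF y] ev[OF z] R.finsum_ldistr)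
        also have "\<dots> = (\<Oplus>\<^bsub>R\<^esub>\<rho>\<in>?C. \<Oplus>\<^bsub>R\<^esub>\<tau>\<in>?C. x \<rho> \<otimes>\<^bsub>R\<^esub> y (inv\<^bsub>\<Gamma>\<^esub> \<rho> \<otimes>\<^bsub>\<Gamma>\<^esub> \<tau>) \<otimes>\<^bsub>R\<^esub> z (inv\<^bsub>\<Gamma>\<^esub> \<tau> \<otimes>\<^bsub>\<Gamma>\<^esub> \<sigma>))"
          using s x y z fin
          by (intro R.finsum_swap) (auto intro!: R.m_closed ev[OF x] ev[OF y] ev[OF z])
        also have "\<dots> = (\<Oplus>\<^bsub>R\<^esub>\<rho>\<in>?C. x \<rho> \<otimes>\<^bsub>R\<^esub> (\<Oplus>\<^bsub>R\<^esub>\<tau>\<in>?C. y \<tau> \<otimes>\<^bsub>R\<^esub> z (inv\<^bsub>\<Gamma>\<^esub> \<tau> \<otimes>\<^bsub>\<Gamma>\<^esub> (inv\<^bsub>\<Gamma>\<^esub> \<rho> \<otimes>\<^bsub>\<Gamma>\<^esub> \<sigma>))))"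
        proof (rule R.finsum_cong'[OF refl])
          fix \<rho> assume r: "\<rho> \<in> ?C"
          have img: "(\<lambda>\<tau>. \<rho> \<otimes>\<^bsub>\<Gamma>\<^esub> \<tau>) ` ?C = ?C" using r by (rule G.surj_const_mult)
          have "(\<Oplus>\<^bsub>R\<^esub>\<tau>\<in>?C. x \<rho> \<otimes>\<^bsub>R\<^esub> y (inv\<^bsub>\<Gamma>\<^esub> \<rho> \<otimes>\<^bsub>\<Gamma>\<^esub> \<tau>) \<otimes>\<^bsub>R\<^esub> z (inv\<^bsub>\<Gamma>\<^esub> \<tau> \<otimes>\<^bsub>\<Gamma>\<^esub> \<sigma>)) =
            (\<Oplus>\<^bsub>R\<^esub>\<tau>\<in>(\<lambda>\<tau>. \<rho> \<otimes>\<^bsub>\<Gamma>\<^esub> \<tau>) ` ?C. x \<rho> \<otimes>\<^bsub>R\<^esub> y (inv\<^bsub>\<Gamma>\<^esub> \<rho> \<otimes>\<^bsub>\<Gamma>\<^esub> \<tau>) \<otimes>\<^bsub>R\<^esub> z (inv\<^bsub>\<Gamma>\<^esub> \<tau> \<otimes>\<^bsub>\<Gamma>\<^esub> \<sigma>))"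
            by (simp only: img)
          also have "\<dots> = (\<Oplus>\<^bsub>R\<^esub>\<tau>\<in>?C. x \<rho> \<otimes>\<^bsub>R\<^esub> y (inv\<^bsub>\<Gamma>\<^esub> \<rho> \<otimes>\<^bsub>\<Gamma>\<^esub> (\<rho> \<otimes>\<^bsub>\<Gamma>\<^esub> \<tau>)) \<otimes>\<^bsub>R\<^esub> z (inv\<^bsub>\<Gamma>\<^esub> (\<rho> \<otimes>\<^bsub>\<Gamma>\<^esub> \<tau>) \<otimes>\<^bsub>\<Gamma>\<^esub> \<sigma>))"
            using r s x y z
            by (intro R.finsum_reindex G.inj_on_cmult) (auto intro!: R.m_closed ev[OF x] ev[OF y] ev[OF z])
          also have "\<dots> = (\<Oplus>\<^bsub>R\<^esub>\<tau>\<in>?C. x \<rho> \<otimes>\<^bsub>R\<^esub> (y \<tau> \<otimes>\<^bsub>R\<^esub> z (inv\<^bsub>\<Gamma>\<^esub> \<tau> \<otimes>\<^bsub>\<Gamma>\<^esub> (inv\<^bsub>\<Gamma>\<^esub> \<rho> \<otimes>\<^bsub>\<Gamma>\<^esub> \<sigma>))))"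
            using r s x y z
            by (intro R.finsum_cong')
              (auto intro!: R.m_closed ev[OF x] ev[OF y] ev[OF z] simp: R.m_assoc ev G.inv_mult_group G.m_assoc G.inv_solve_left' G.m_assoc[symmetric, of "inv\<^bsub>\<Gamma>\<^esub> \<rho>" \<rho>])
          also have "\<dots> = x \<rho> \<otimes>\<^bsub>R\<^esub> (\<Oplus>\<^bsub>R\<^esub>\<tau>\<in>?C. y \<tau> \<otimes>\<^bsub>R\<^esub> z (inv\<^bsub>\<Gamma>\<^esub> \<tau> \<otimes>\<^bsub>\<Gamma>\<^esub> (inv\<^bsub>\<Gamma>\<^esub> \<rho> \<otimes>\<^bsub>\<Gamma>\<^esub> \<sigma>)))"
            using r s x y z fin by (intro R.finsum_rdistr[symmetric]) (auto intro!: R.m_closed ev[OF x] ev[OF y] ev[OF z])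
          finally show "(\<Oplus>\<^bsub>R\<^esub>\<tau>\<in>?C. x \<rho> \<otimes>\<^bsub>R\<^esub> y (inv\<^bsub>\<Gamma>\<^esub> \<rho> \<otimes>\<^bsub>\<Gamma>\<^esub> \<tau>) \<otimes>\<^bsub>R\<^esub> z (inv\<^bsub>\<Gamma>\<^esub> \<tau> \<otimes>\<^bsub>\<Gamma>\<^esub> \<sigma>)) = \<dots>" .
        qed (use s x y z in \<open>auto intro!: R.m_closed R.finsum_closed ev[OF x] ev[OF y] ev[OF z]\<close>)
        also have "\<dots> = (x \<otimes>\<^bsub>?S\<^esub> (y \<otimes>\<^bsub>?S\<^esub> z)) \<sigma>"
          using s x y z
          by (subst mult, simp) (auto intro!: R.finsum_cong' R.m_closed R.finsum_closed ev[OF x] ev[OF y] ev[OF z] simp: mult)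
        finally show "(x \<otimes>\<^bsub>?S\<^esub> y \<otimes>\<^bsub>?S\<^esub> z) \<sigma> = (x \<otimes>\<^bsub>?S\<^esub> (y \<otimes>\<^bsub>?S\<^esub> z)) \<sigma>" .
      qed
    next
      fix x assume x: "x \<in> carrier ?S"
      show "\<one>\<^bsub>?S\<^esub> \<otimes>\<^bsub>?S\<^esub> x = x"
      proof (intro eqI mult_closed one x)
        fix \<sigma> assume s: "\<sigma> \<in> carrier \<Gamma>"
        have "(\<one>\<^bsub>?S\<^esub> \<otimes>\<^bsub>?S\<^esub> x) \<sigma> =
          (\<Oplus>\<^bsub>R\<^esub>\<rho>\<in>carrier \<Gamma>. if \<one>\<^bsub>\<Gamma>\<^esub> = \<rho> then x (inv\<^bsub>\<Gamma>\<^esub> \<rho> \<otimes>\<^bsub>\<Gamma>\<^esub> \<sigma>) else \<zero>\<^bsub>R\<^esub>)"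
          unfolding mult[OF s] using s x
          by (intro R.finsum_cong') (auto simp: group_ring_def intro!: R.l_one R.l_null)
        also have "\<dots> = x (inv\<^bsub>\<Gamma>\<^esub> \<one>\<^bsub>\<Gamma>\<^esub> \<otimes>\<^bsub>\<Gamma>\<^esub> \<sigma>)"
          using s x fin by (intro R.finsum_singleton) (auto intro!: ev[OF x])
        finally show "(\<one>\<^bsub>?S\<^esub> \<otimes>\<^bsub>?S\<^esub> x) \<sigma> = x \<sigma>" using s by simp
      qed
    qed (auto intro: mult_closed one)
    fix x y z assume x: "x \<in> carrier ?S" and y: "y \<in> carrier ?S" and z: "z \<in> carrier ?S"
    show "(x \<oplus>\<^bsub>?S\<^esub> y) \<otimes>\<^bsub>?S\<^esub> z = x \<otimes>\<^bsub>?S\<^esub> z \<oplus>\<^bsub>?S\<^esub> y \<otimes>\<^bsub>?S\<^esub> z"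
    proof (intro eqI mult_closed add_closed x y z)
      fix \<sigma> assume s: "\<sigma> \<in> carrier \<Gamma>"
      have "((x \<oplus>\<^bsub>?S\<^esub> y) \<otimes>\<^bsub>?S\<^esub> z) \<sigma> = (\<Oplus>\<^bsub>R\<^esub>\<rho>\<in>carrier \<Gamma>.
          x \<rho> \<otimes>\<^bsub>R\<^esub> z (inv\<^bsub>\<Gamma>\<^esub> \<rho> \<otimes>\<^bsub>\<Gamma>\<^esub> \<sigma>) \<oplus>\<^bsub>R\<^esub> y \<rho> \<otimes>\<^bsub>R\<^esub> z (inv\<^bsub>\<Gamma>\<^esub> \<rho> \<otimes>\<^bsub>\<Gamma>\<^esub> \<sigma>))"
        unfolding mult[OF s] using s x y z
        by (intro R.finsum_cong') (auto simp: add intro!: R.l_distr R.m_closed ev[OF x] ev[OF y] ev[OF z])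
      also have "\<dots> = (x \<otimes>\<^bsub>?S\<^esub> z \<oplus>\<^bsub>?S\<^esub> y \<otimes>\<^bsub>?S\<^esub> z) \<sigma>"
        unfolding add[OF s] mult[OF s] using s x y z
        by (intro R.finsum_addf) (auto intro!: R.m_closed ev[OF x] ev[OF y] ev[OF z])
      finally show "((x \<oplus>\<^bsub>?S\<^esub> y) \<otimes>\<^bsub>?S\<^esub> z) \<sigma> = (x \<otimes>\<^bsub>?S\<^esub> z \<oplus>\<^bsub>?S\<^esub> y \<otimes>\<^bsub>?S\<^esub> z) \<sigma>" .
    qed
  qed
qed

text \<open>The element \<open>c \<sigma>\<close> of \<open>R[\<Gamma>]\<close>. The group element \<open>\<sigma>\<close> is \<open>gr_single R \<Gamma> \<one> \<sigma>\<close>, and the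
  scalar \<open>c \<in> R\<close> is \<open>gr_single R \<Gamma> c \<one>\<close>.\<close>

definition gr_single :: "('r, 'y) ring_scheme \<Rightarrow> ('g, 'x) monoid_scheme \<Rightarrow> 'r \<Rightarrow> 'g \<Rightarrow> 'g \<Rightarrow> 'r" where
  "gr_single R \<Gamma> c \<sigma> = (\<lambda>\<rho>\<in>carrier \<Gamma>. if \<rho> = \<sigma> then c else \<zero>\<^bsub>R\<^esub>)"

text \<open>Restriction of scalars of an \<open>R[G]\<close>-module along \<open>R[H] \<subseteq> R[G]\<close> for a subgroup \<open>H\<close>;
  the inclusion is extension by zero.\<close>

definition gr_restrict ::
  "('r, 'y) ring_scheme \<Rightarrow> ('g, 'x) monoid_scheme \<Rightarrow> 'g set \<Rightarrow> ('g \<Rightarrow> 'r, 'm, 'z) module_scheme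
    \<Rightarrow> ('g \<Rightarrow> 'r, 'm, 'z) module_scheme" where
  "gr_restrict R G H M =
     M\<lparr>smult := (\<lambda>a m. (\<lambda>\<sigma>\<in>carrier G. if \<sigma> \<in> H then a \<sigma> else \<zero>\<^bsub>R\<^esub>) \<odot>\<^bsub>M\<^esub> m)\<rparr>"

definition smult_image :: "'a \<Rightarrow> ('a, 'm, 'z) module_scheme \<Rightarrow> 'm set" where
  "smult_image a N = (\<lambda>n. a \<odot>\<^bsub>N\<^esub> n) ` carrier N"


subsection \<open>Isotypic parts and modified Tate cohomology\<close>

text \<open>Throughout, \<open>\<iota>\<close> is the structure map \<open>\<int>[\<zeta>] \<rightarrow> R\<close>, and \<open>N\<close> is an \<open>R[\<Gamma>]\<close>-module.\<close>

definition isotypic ::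
  "('r, 'y) ring_scheme \<Rightarrow> (complex \<Rightarrow> 'r) \<Rightarrow> ('g, 'x) monoid_scheme \<Rightarrow> ('g \<Rightarrow> complex)
    \<Rightarrow> ('g \<Rightarrow> 'r, 'm, 'z) module_scheme \<Rightarrow> 'm set" where
  "isotypic R \<iota> \<Gamma> \<chi> N = {m \<in> carrier N. \<forall>\<sigma>\<in>carrier \<Gamma>.
     gr_single R \<Gamma> \<one>\<^bsub>R\<^esub> \<sigma> \<odot>\<^bsub>N\<^esub> m = gr_single R \<Gamma> (\<iota> (\<chi> \<sigma>)) \<one>\<^bsub>\<Gamma>\<^esub> \<odot>\<^bsub>N\<^esub> m}"

text \<open>For an \<open>R[G]\<close>-module \<open>M\<close>, subgroups \<open>H\<close>, \<open>K\<close> of \<open>G\<close> and a character \<open>\<psi>\<close> of \<open>H\<close>: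
  the isotypic part \<open>M\<^sup>\<psi>\<close> for the action of \<open>H\<close>, regarded as an \<open>R[K]\<close>-module.\<close>

definition isotypic_module ::
  "('r, 'y) ring_scheme \<Rightarrow> (complex \<Rightarrow> 'r) \<Rightarrow> ('g, 'x) monoid_scheme \<Rightarrow> 'g set \<Rightarrow> ('g \<Rightarrow> complex)
    \<Rightarrow> 'g set \<Rightarrow> ('g \<Rightarrow> 'r, 'm, 'z) module_scheme \<Rightarrow> ('g \<Rightarrow> 'r, 'm, 'z) module_scheme" where
  "isotypic_module R \<iota> G H \<psi> K M =
     (gr_restrict R G K M)\<lparr>carrier := isotypic R \<iota> (G\<lparr>carrier := H\<rparr>) \<psi> (gr_restrict R G H M)\<rparr>"

definition char_eps ::
  "(complex \<Rightarrow> 'r) \<Rightarrow> ('g, 'x) monoid_scheme \<Rightarrow> ('g \<Rightarrow> complex) \<Rightarrow> 'g \<Rightarrow> 'r" where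
  "char_eps \<iota> \<Gamma> \<chi> = (\<lambda>\<sigma>\<in>carrier \<Gamma>. \<iota> (inverse (\<chi> \<sigma>)))"

text \<open>Only orders are needed, so quotient modules are formed as quotients of additive groups.\<close>

definition tate_H0 ::
  "('r, 'y) ring_scheme \<Rightarrow> (complex \<Rightarrow> 'r) \<Rightarrow> ('g, 'x) monoid_scheme \<Rightarrow> ('g \<Rightarrow> complex)
    \<Rightarrow> ('g \<Rightarrow> 'r, 'm, 'z) module_scheme \<Rightarrow> 'm set monoid" where
  "tate_H0 R \<iota> \<Gamma> \<chi> N =
     add_monoid (N\<lparr>carrier := isotypic R \<iota> \<Gamma> \<chi> N\<rparr>) Mod smult_image (char_eps \<iota> \<Gamma> \<chi>) N"

text \<open>For a cyclic group \<open>\<Gamma>\<close> of order \<open>m\<close> with generator \<open>\<tau>\<close>: the root of unity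
  \<open>\<zeta>\<^sub>m = \<zeta>\<^sub>e\<^bsup>e/m\<^esup>\<close>, the character \<open>\<xi>\<close> with \<open>\<xi>(\<tau>) = \<zeta>\<^sub>m\<close>, and the exponent \<open>k < m\<close>
  with \<open>\<chi> = \<xi>\<^sup>k\<close>.\<close>

definition cyc_root :: "nat \<Rightarrow> complex \<Rightarrow> ('g, 'x) monoid_scheme \<Rightarrow> complex" where
  "cyc_root e \<zeta> \<Gamma> = \<zeta> ^ (e div Coset.order \<Gamma>)"

definition cyc_char :: "nat \<Rightarrow> complex \<Rightarrow> ('g, 'x) monoid_scheme \<Rightarrow> 'g \<Rightarrow> 'g \<Rightarrow> complex" where
  "cyc_char e \<zeta> \<Gamma> \<tau> = (THE \<xi>. \<xi> \<in> characters e \<Gamma> \<and> \<xi> \<tau> = cyc_root e \<zeta> \<Gamma>)"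

definition char_index ::
  "nat \<Rightarrow> complex \<Rightarrow> ('g, 'x) monoid_scheme \<Rightarrow> 'g \<Rightarrow> ('g \<Rightarrow> complex) \<Rightarrow> nat" where
  "char_index e \<zeta> \<Gamma> \<tau> \<chi> =
     (THE k. k < Coset.order \<Gamma> \<and> \<chi> = (\<lambda>\<sigma>\<in>carrier \<Gamma>. cyc_char e \<zeta> \<Gamma> \<tau> \<sigma> ^ k))"

definition tail_product ::
  "('r, 'y) ring_scheme \<Rightarrow> (complex \<Rightarrow> 'r) \<Rightarrow> nat \<Rightarrow> complex \<Rightarrow> ('g, 'x) monoid_scheme \<Rightarrow> 'g
    \<Rightarrow> nat \<Rightarrow> 'g \<Rightarrow> 'r" where
  "tail_product R \<iota> e \<zeta> \<Gamma> \<tau> k =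
     (\<Otimes>\<^bsub>group_ring R \<Gamma>\<^esub>j\<in>{k + 1..Coset.order \<Gamma> - 1}.
        gr_single R \<Gamma> \<one>\<^bsub>R\<^esub> \<tau>
          \<ominus>\<^bsub>group_ring R \<Gamma>\<^esub> gr_single R \<Gamma> (\<iota> (cyc_root e \<zeta> \<Gamma> ^ j)) \<one>\<^bsub>\<Gamma>\<^esub>)"

text \<open>A coset does not depend on the carrier of the ambient group, so this set of cosets is
  literally a subset of the carrier of \<open>tate_H0 R \<iota> \<Gamma> \<chi> N\<close>.\<close>

definition S_sub ::
  "('r, 'y) ring_scheme \<Rightarrow> (complex \<Rightarrow> 'r) \<Rightarrow> nat \<Rightarrow> complex \<Rightarrow> ('g, 'x) monoid_scheme \<Rightarrow> 'g
    \<Rightarrow> ('g \<Rightarrow> complex) \<Rightarrow> ('g \<Rightarrow> 'r, 'm, 'z) module_scheme \<Rightarrow> 'm set set" where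
  "S_sub R \<iota> e \<zeta> \<Gamma> \<tau> \<chi> N =
     carrier (add_monoid (N\<lparr>carrier := isotypic R \<iota> \<Gamma> \<chi> N \<inter>
                smult_image (tail_product R \<iota> e \<zeta> \<Gamma> \<tau> (char_index e \<zeta> \<Gamma> \<tau> \<chi>)) N\<rparr>)
              Mod smult_image (char_eps \<iota> \<Gamma> \<chi>) N)"


subsection \<open>Partial products of a family of subgroups\<close>

text \<open>\<open>G\<^sub>i = K\<^sub>1 \<cdots> K\<^sub>i\<close>, which is trivial for \<open>i = 0\<close>.\<close>

definition partial_product :: "('g, 'x) monoid_scheme \<Rightarrow> (nat \<Rightarrow> 'g set) \<Rightarrow> nat \<Rightarrow> 'g set" where
  "partial_product G K i = (\<lambda>k. finprod G k {1..i}) ` (\<Pi>\<^sub>E j\<in>{1..i}. K j)"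

end

theory Submission
  imports Defs
begin

text \<open>
  Let \<open>K\<close> be cyclic of order \<open>m\<close> with generator \<open>\<tau>\<close>, let \<open>z = \<zeta>\<^sub>m\<close>, and let \<open>N\<close> be a finite
  \<open>R[K]\<close>-module. Put \<open>F\<^sub>k = (\<tau> - z\<^sup>k) \<cdots> (\<tau> - z\<^bsup>m-1\<^esup>) N\<close>. Since \<open>\<tau>\<^sup>m = 1\<close>, the chain
  \<open>N = F\<^sub>m \<supseteq> \<dots> \<supseteq> F\<^sub>0\<close> ends in \<open>0\<close>, and \<open>\<tau> - z\<^sup>k\<close> maps \<open>F\<^bsub>k+1\<^esub>\<close> onto \<open>F\<^sub>k\<close> with
  kernel the \<open>\<xi>\<^sup>k\<close>-part of \<open>F\<^bsub>k+1\<^esub>\<close>, so \<open>[N]\<close> is the product of the orders of these kernels.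
  Such a kernel is the numerator of \<open>S\<close> for the character \<open>\<xi>\<^sup>k\<close>: up to the unit \<open>z\<^sup>k\<close>, the element
  \<open>\<epsilon>\<close> is the product of all \<open>\<tau> - z\<^sup>j\<close> with \<open>j \<noteq> k\<close>. This gives the theorem for one cyclic
  factor. Applied to \<open>M\<^sup>\<psi>\<close> for the characters \<open>\<psi>\<close> of \<open>G\<^bsub>i-1\<^esub>\<close>, it expresses the \<open>i\<close>-th factor as
  the quotient of \<open>\<Prod>[M\<^sup>\<theta>]\<close> over the characters of \<open>G\<^sub>i\<close> by the same product for \<open>G\<^bsub>i-1\<^esub>\<close>, and
  the product over \<open>i\<close> telescopes.
\<close>

section \<open>Roots of unity and evaluation of complex polynomials\<close>

lemma primitive_root_of_unity_power:
  assumes "primitive_root_of_unity e \<zeta>" "m dvd e"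
  shows "primitive_root_of_unity m (\<zeta> ^ (e div m))"
proof -
  from assms have e: "e > 0" "\<zeta> ^ e = 1" "\<And>k. 0 < k \<Longrightarrow> k < e \<Longrightarrow> \<zeta> ^ k \<noteq> 1"
    by (auto simp: primitive_root_of_unity_def)
  obtain d where d: "e = m * d" using assms(2) by (auto elim: dvdE)
  with e have "m > 0" "d > 0" by auto
  then show ?thesis
    using e by (auto simp: primitive_root_of_unity_def d simp flip: power_mult) (simp add: mult.commute)
qed

text \<open>Primitivity makes the m powers distinct, and X^m - 1 has at most m roots, so counting
  gives surjectivity.\<close>

lemma primitive_root_of_unity_powers:
  assumes "primitive_root_of_unity m z"
  shows "bij_betw (\<lambda>j. z ^ j) {..<m} {w. w ^ m = 1}"
proof -
  from assms have m: "m > 0" "z ^ m = 1" "\<And>k. 0 < k \<Longrightarrow> k < m \<Longrightarrow> z ^ k \<noteq> 1"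
    by (auto simp: primitive_root_of_unity_def)
  then have z0: "z \<noteq> 0" by (metis power_0_left not_gr_zero zero_neq_one)
  have ne: "z ^ i \<noteq> z ^ j" if "i < j" "j < m" for i j
  proof
    assume "z ^ i = z ^ j"
    also have "z ^ j = z ^ i * z ^ (j - i)" using that by (simp flip: power_add)
    finally have "z ^ (j - i) = 1" using z0 by simp
    then show False using m(3)[of "j - i"] that by simp
  qed
  have inj: "inj_on (\<lambda>j. z ^ j) {..<m}"
  proof (rule inj_onI)
    fix i j assume "i \<in> {..<m}" "j \<in> {..<m}" "z ^ i = z ^ j"
    then show "i = j" using ne[of i j] ne[of j i] by (metis lessThan_iff nat_neq_iff)
  qed
  have "(z ^ j) ^ m = 1" for j
    using m(2) by (metis mult.commute power_mult power_one)
  then have sub: "(\<lambda>j. z ^ j) ` {..<m} \<subseteq> {w. w ^ m = 1}" by auto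
  have "card {w::complex. w ^ m = 1} \<le> card ((\<lambda>j. z ^ j) ` {..<m})"
    using card_roots_unity[of m] m(1) card_image[OF inj] by simp
  with sub have "(\<lambda>j. z ^ j) ` {..<m} = {w. w ^ m = 1}"
    using finite_roots_unity[of m] m(1) by (intro card_seteq) auto
  with inj show ?thesis by (simp add: bij_betw_def)
qed

text \<open>Both sides are monic of degree m, so their difference has degree below m. Were it
  nonzero, it would still vanish at the m distinct m-th roots of unity.\<close>

lemma prod_linear_roots_of_unity:
  assumes "primitive_root_of_unity m z"
  shows "(\<Prod>j<m. [:- (z ^ j), 1:]) = monom 1 m - 1"
proof -
  let ?p = "\<Prod>j<m. [:- (z ^ j), 1:]" and ?q = "monom 1 m - 1 :: complex poly"
  have m: "m > 0" using assms by (simp add: primitive_root_of_unity_def)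
  note b = primitive_root_of_unity_powers[OF assms]
  show ?thesis
  proof (rule ccontr)
    assume ne: "?p \<noteq> ?q"
    have deg: "Polynomial.degree ?p = m"
      by (subst degree_prod_sum_eq) auto
    moreover have "lead_coeff ?p = 1" by (simp add: lead_coeff_prod)
    ultimately have p: "poly.coeff ?p m = 1" by simp
    have q: "poly.coeff ?q m = 1" using m by simp
    have "Polynomial.degree ?q \<le> m"
      by (rule degree_diff_le[OF degree_monom_le]) simp
    with deg have "Polynomial.degree (?p - ?q) \<le> m" by (rule degree_diff_le[OF eq_refl])
    moreover have "poly.coeff (?p - ?q) m = 0" using p q by simp
    ultimately have "Polynomial.degree (?p - ?q) < m"
      using ne by (metis le_neq_implies_less leading_coeff_0_iff right_minus_eq)
    moreover have "{w. w ^ m = 1} \<subseteq> {w. poly (?p - ?q) w = 0}"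
    proof
      fix w :: complex assume w: "w \<in> {w. w ^ m = 1}"
      then obtain j where "j < m" "w = z ^ j" using b by (auto simp: bij_betw_def)
      then have "poly ?p w = 0" by (auto simp: poly_prod intro!: prod_zero)
      with w show "w \<in> {w. poly (?p - ?q) w = 0}" by (simp add: poly_monom)
    qed
    then have "m \<le> card {w. poly (?p - ?q) w = 0}"
      using bij_betw_same_card[OF b] ne by (metis card_lessThan card_mono poly_roots_finite right_minus_eq)
    moreover have "card {w. poly (?p - ?q) w = 0} \<le> Polynomial.degree (?p - ?q)"
      using ne by (intro card_poly_roots_bound) simp
    ultimately show False by simp
  qed
qed

text \<open>The right-hand side is the polynomial form of \<epsilon> for \<chi> = \<xi>^k: its
  coefficient at X^a is the inverse of \<chi>(\<tau>^a) = z^(k*a), written with a nonnegative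
  exponent. Both sides times X - z^k equal z^k (X^m - 1), and the linear factor cancels.\<close>

lemma prod_linear_roots_of_unity_omit:
  assumes "primitive_root_of_unity m z" "k < m"
  shows "smult (z ^ k) (\<Prod>j\<in>{..<m} - {k}. [:- (z ^ j), 1:]) = (\<Sum>a<m. monom (z ^ (k * (m - a))) a)"
    (is "smult _ ?P = ?S")
proof -
  define y where "y = z ^ k"
  have ym: "y ^ m = 1"
    using assms by (metis primitive_root_of_unity_def mult.commute power_mult power_one y_def)
  have m: "m > 0" using assms by simp
  have "[:- y, 1:] * ?S = (\<Sum>a<m. monom (y ^ (m - a)) (Suc a) - monom (y * y ^ (m - a)) a)"
    unfolding sum_distrib_left y_def power_mult
    by (intro sum.cong) (simp_all add: smult_monom monom_Suc minus_monom[symmetric] del: minus_monom)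
  \<comment> \<open>One factor y is split off, possible since a < m. Each summand is then f (a+1) -
    f a for f a = y y^(m-a) X^a, and the sum telescopes.\<close>
  also have "\<dots> = (\<Sum>a<m. monom (y * y ^ (m - Suc a)) (Suc a) - monom (y * y ^ (m - a)) a)"
    by (intro sum.cong) (auto simp: Suc_diff_Suc simp flip: power_Suc)
  also have "\<dots> = monom (y * y ^ (m - m)) m - monom (y * y ^ (m - 0)) 0"
    by (rule sum_lessThan_telescope)
  also have "\<dots> = smult y (monom 1 m - 1)"
    by (simp add: ym smult_monom smult_diff_right monom_0 one_pCons)
  also have "\<dots> = smult y ([:- y, 1:] * ?P)"
    using assms by (simp flip: prod_linear_roots_of_unity add: prod.remove[of _ k] y_def)
  finally have "[:- y, 1:] * ?S = [:- y, 1:] * smult y ?P" by (simp only: mult_smult_right)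
  then have "?S = smult y ?P" by (subst (asm) mult_left_cancel) auto
  then show ?thesis by (simp add: y_def)
qed

section \<open>Evaluation of polynomials at an element of a commutative ring\<close>

locale poly_evaluation = A: cring A for A :: "('b, 'c) ring_scheme" (structure) +
  fixes Z :: "'a::comm_ring_1 set" and c :: "'a \<Rightarrow> 'b" and t :: 'b
  assumes Z_zero: "0 \<in> Z" and Z_one: "1 \<in> Z"
    and Z_add: "\<And>x y. x \<in> Z \<Longrightarrow> y \<in> Z \<Longrightarrow> x + y \<in> Z"
    and Z_mult: "\<And>x y. x \<in> Z \<Longrightarrow> y \<in> Z \<Longrightarrow> x * y \<in> Z"
    and Z_minus: "\<And>x. x \<in> Z \<Longrightarrow> - x \<in> Z"
    and c_closed: "\<And>x. x \<in> Z \<Longrightarrow> c x \<in> carrier A"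
    and c_one: "c 1 = \<one>"
    and c_add: "\<And>x y. x \<in> Z \<Longrightarrow> y \<in> Z \<Longrightarrow> c (x + y) = c x \<oplus> c y"
    and c_mult: "\<And>x y. x \<in> Z \<Longrightarrow> y \<in> Z \<Longrightarrow> c (x * y) = c x \<otimes> c y"
    and t_closed: "t \<in> carrier A"
begin

lemma c_zero: "c 0 = \<zero>"
  using c_add[OF Z_zero Z_zero] c_closed[OF Z_zero] A.add.l_cancel_one'[of "c 0" "c 0"] by simp

lemma c_minus: "x \<in> Z \<Longrightarrow> c (- x) = \<ominus> c x"
  using c_add[of "- x" x] Z_minus[of x] c_closed[of x] c_closed[of "- x"] c_zero
  by (intro A.minus_equality[symmetric]) auto

text \<open>The coefficient map \<open>c\<close> is a homomorphism only on the subring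
  \<open>Z\<close>, so polynomial identities carry over to the ring only for coefficients in
  \<open>Z\<close>. The later instance has \<open>Z\<close> = Z[\<zeta>], the scalars of the group
  ring as \<open>c\<close>, and the generator \<tau> as \<open>t\<close>.\<close>

definition Z_polys :: "'a poly set" where
  "Z_polys = {p. \<forall>i. poly.coeff p i \<in> Z}"

text \<open>Horner's scheme, which gives a recursion along \<open>pCons\<close> without reference to
  degrees.\<close>

definition eval_at :: "'a poly \<Rightarrow> 'b" where
  "eval_at p = fold_coeffs (\<lambda>a x. c a \<oplus> t \<otimes> x) p \<zero>"

lemma Z_polys_pCons [simp]: "pCons a p \<in> Z_polys \<longleftrightarrow> a \<in> Z \<and> p \<in> Z_polys"
  by (auto simp: Z_polys_def coeff_pCons split: nat.splits)

lemma Z_polys_0 [simp]: "0 \<in> Z_polys" by (simp add: Z_polys_def Z_zero)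

lemma Z_polys_add: "p \<in> Z_polys \<Longrightarrow> q \<in> Z_polys \<Longrightarrow> p + q \<in> Z_polys"
  by (auto simp: Z_polys_def intro: Z_add)

lemma Z_polys_smult: "a \<in> Z \<Longrightarrow> p \<in> Z_polys \<Longrightarrow> smult a p \<in> Z_polys"
  by (auto simp: Z_polys_def intro: Z_mult)

lemma Z_polys_monom: "a \<in> Z \<Longrightarrow> monom a n \<in> Z_polys"
  by (auto simp: Z_polys_def Z_zero)

lemma Z_polys_sum: "(\<And>j. j \<in> J \<Longrightarrow> p j \<in> Z_polys) \<Longrightarrow> sum p J \<in> Z_polys"
  by (induction J rule: infinite_finite_induct) (auto intro: Z_polys_add)

text \<open>Reduces multiplication by a linear factor to \<open>pCons\<close>, addition and
  \<open>smult\<close>, whose effect on coefficients and on \<open>eval_at\<close> is known; both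
  lemmas on products of linear factors rest on it.\<close>

lemma mult_linear: "(p :: 'a poly) * [:- b, 1:] = pCons 0 p + smult (- b) p"
  by (simp add: add.commute)

lemma Z_polys_prod_linear:
  "(\<And>j. j \<in> J \<Longrightarrow> b j \<in> Z) \<Longrightarrow> (\<Prod>j\<in>J. [:- b j, 1:]) \<in> Z_polys"
proof (induction J rule: infinite_finite_induct)
  case (insert j J)
  then have "(\<Prod>j\<in>J. [:- b j, 1:]) \<in> Z_polys" by simp
  then show ?case
    using insert by (subst prod.insert, simp, simp, subst mult.commute, subst mult_linear)
      (auto simp del: Polynomial.smult_minus_left intro!: Z_polys_add Z_polys_smult Z_minus Z_zero)
qed (auto simp: one_pCons Z_one)

lemma eval_at_0 [simp]: "eval_at 0 = \<zero>" by (simp add: eval_at_def)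

lemma eval_at_pCons [simp]: "eval_at (pCons a p) = c a \<oplus> t \<otimes> eval_at p"
  by (cases "p = 0 \<and> a = 0") (auto simp: eval_at_def c_zero t_closed)

lemma eval_at_closed: "p \<in> Z_polys \<Longrightarrow> eval_at p \<in> carrier A"
  by (induction p) (auto simp: c_closed t_closed)

lemma eval_at_add:
  "p \<in> Z_polys \<Longrightarrow> q \<in> Z_polys \<Longrightarrow> eval_at (p + q) = eval_at p \<oplus> eval_at q"
proof (induction p q rule: poly_induct2)
  case (pCons a p b q)
  then show ?case
    by (simp add: c_add c_closed t_closed eval_at_closed A.r_distr A.a_ac)
qed simp

lemma eval_at_smult:
  "a \<in> Z \<Longrightarrow> p \<in> Z_polys \<Longrightarrow> eval_at (smult a p) = c a \<otimes> eval_at p"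
proof (induction p)
  case (pCons b p)
  then show ?case
    by (simp add: c_mult c_closed t_closed eval_at_closed A.r_distr A.m_lcomm)
qed (simp add: c_closed)

lemma eval_at_monom: "a \<in> Z \<Longrightarrow> eval_at (monom a n) = c a \<otimes> t [^] n"
  by (induction n) (auto simp: monom_0 monom_Suc c_zero c_closed t_closed Z_zero A.m_ac)

lemma eval_at_sum:
  "(\<And>j. j \<in> J \<Longrightarrow> p j \<in> Z_polys) \<Longrightarrow> eval_at (sum p J) = (\<Oplus>j\<in>J. eval_at (p j))"
proof (induction J rule: infinite_finite_induct)
  case (insert j J)
  then show ?case
    by (simp add: eval_at_add Z_polys_sum eval_at_closed A.finsum_insert Pi_def)
qed auto

lemma eval_at_prod_linear:
  "(\<And>j. j \<in> J \<Longrightarrow> b j \<in> Z) \<Longrightarrow>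
    eval_at (\<Prod>j\<in>J. [:- b j, 1:]) = (\<Otimes>j\<in>J. t \<ominus> c (b j))"
proof (induction J rule: infinite_finite_induct)
  case (insert j J)
  let ?p = "\<Prod>j\<in>J. [:- b j, 1:]"
  have p: "?p \<in> Z_polys" using insert by (intro Z_polys_prod_linear) auto
  have b: "b j \<in> Z" using insert by simp
  have "eval_at (\<Prod>j\<in>insert j J. [:- b j, 1:]) = eval_at (?p * [:- b j, 1:])"
    using insert by (simp add: mult.commute)
  also have "\<dots> = (t \<ominus> c (b j)) \<otimes> eval_at ?p"
    unfolding mult_linear using p b
    by (simp del: Polynomial.smult_minus_left add: eval_at_add eval_at_smult Z_polys_smult Z_minus Z_zero c_zero c_minus
        A.minus_eq A.l_distr c_closed t_closed eval_at_closed)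
  also have "\<dots> = (\<Otimes>j\<in>insert j J. t \<ominus> c (b j))"
    using insert by (simp add: c_closed t_closed A.finprod_insert Pi_def)
  finally show ?case .
qed (auto simp: one_pCons c_one t_closed)

end

section \<open>Group rings\<close>

text \<open>The inclusion of R[H] in R[G] through which \<open>gr_restrict\<close> lets R[H]
  act.\<close>

definition gr_extend :: "('r, 'y) ring_scheme \<Rightarrow> ('g, 'x) monoid_scheme \<Rightarrow> 'g set \<Rightarrow> ('g \<Rightarrow> 'r) \<Rightarrow> 'g \<Rightarrow> 'r" where
  "gr_extend R G H a = (\<lambda>\<sigma>\<in>carrier G. if \<sigma> \<in> H then a \<sigma> else \<zero>\<^bsub>R\<^esub>)"

lemma (in comm_group) comm_group_subgroup: "subgroup H G \<Longrightarrow> comm_group (G\<lparr>carrier := H\<rparr>)"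
  by (rule group.group_comm_groupI[OF subgroup_imp_group]) (auto intro: m_comm dest: subgroup.mem_carrier)

locale finite_group_ring = G: comm_group G + R: cring R
  for G :: "('g, 'x) monoid_scheme" (structure) and R :: "('r, 'y) ring_scheme" +
  assumes finite_G: "finite (carrier G)"
begin

abbreviation "A \<equiv> group_ring R G"

sublocale A: cring A
  by (rule cring_group_ring) (use finite_G G.comm_group_axioms R.cring_axioms in auto)

lemma gr_carrier: "carrier A = carrier G \<rightarrow>\<^sub>E carrier R"
  by (simp add: group_ring_def)

lemma gr_ev: "a \<in> carrier A \<Longrightarrow> \<sigma> \<in> carrier G \<Longrightarrow> a \<sigma> \<in> carrier R"
  by (auto simp: gr_carrier)

lemma gr_eqI:
  assumes "a \<in> carrier A" "b \<in> carrier A" "\<And>\<sigma>. \<sigma> \<in> carrier G \<Longrightarrow> a \<sigma> = b \<sigma>"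
  shows "a = b"
  using assms by (auto simp: gr_carrier intro: PiE_ext)

lemma gr_add: "\<sigma> \<in> carrier G \<Longrightarrow> (a \<oplus>\<^bsub>A\<^esub> b) \<sigma> = a \<sigma> \<oplus>\<^bsub>R\<^esub> b \<sigma>"
  by (simp add: group_ring_def)

lemma gr_mult: "\<sigma> \<in> carrier G \<Longrightarrow>
    (a \<otimes>\<^bsub>A\<^esub> b) \<sigma> = (\<Oplus>\<^bsub>R\<^esub>\<rho>\<in>carrier G. a \<rho> \<otimes>\<^bsub>R\<^esub> b (inv \<rho> \<otimes> \<sigma>))"
  by (simp add: group_ring_def)

lemma gr_zero: "\<sigma> \<in> carrier G \<Longrightarrow> \<zero>\<^bsub>A\<^esub> \<sigma> = \<zero>\<^bsub>R\<^esub>"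
  by (simp add: group_ring_def)

lemma single_closed [simp]: "a \<in> carrier R \<Longrightarrow> gr_single R G a \<sigma> \<in> carrier A"
  by (auto simp: gr_carrier gr_single_def)

lemma single_apply: "\<rho> \<in> carrier G \<Longrightarrow> gr_single R G a \<sigma> \<rho> = (if \<rho> = \<sigma> then a else \<zero>\<^bsub>R\<^esub>)"
  by (simp add: gr_single_def)

lemma single_one: "gr_single R G \<one>\<^bsub>R\<^esub> \<one> = \<one>\<^bsub>A\<^esub>"
  by (simp add: gr_single_def group_ring_def)

lemma single_add:
  assumes "a \<in> carrier R" "b \<in> carrier R"
  shows "gr_single R G (a \<oplus>\<^bsub>R\<^esub> b) \<sigma> = gr_single R G a \<sigma> \<oplus>\<^bsub>A\<^esub> gr_single R G b \<sigma>"
  using assms by (intro gr_eqI) (auto simp: gr_add single_apply)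

lemma single_mult:
  assumes "a \<in> carrier R" "b \<in> carrier R" "\<sigma> \<in> carrier G" "\<rho> \<in> carrier G"
  shows "gr_single R G a \<sigma> \<otimes>\<^bsub>A\<^esub> gr_single R G b \<rho> = gr_single R G (a \<otimes>\<^bsub>R\<^esub> b) (\<sigma> \<otimes> \<rho>)"
proof (rule gr_eqI)
  fix \<kappa> assume k: "\<kappa> \<in> carrier G"
  have "(gr_single R G a \<sigma> \<otimes>\<^bsub>A\<^esub> gr_single R G b \<rho>) \<kappa> =
      (\<Oplus>\<^bsub>R\<^esub>\<mu>\<in>carrier G. if \<sigma> = \<mu> then a \<otimes>\<^bsub>R\<^esub> gr_single R G b \<rho> (inv \<mu> \<otimes> \<kappa>) else \<zero>\<^bsub>R\<^esub>)"
    unfolding gr_mult[OF k] using assms k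
    by (intro R.finsum_cong') (auto simp: single_apply)
  also have "\<dots> = a \<otimes>\<^bsub>R\<^esub> gr_single R G b \<rho> (inv \<sigma> \<otimes> \<kappa>)"
    using assms k finite_G by (intro R.finsum_singleton) (auto simp: single_apply)
  also have "\<dots> = gr_single R G (a \<otimes>\<^bsub>R\<^esub> b) (\<sigma> \<otimes> \<rho>) \<kappa>"
    using assms k by (auto simp: single_apply G.inv_solve_left')
  finally show "(gr_single R G a \<sigma> \<otimes>\<^bsub>A\<^esub> gr_single R G b \<rho>) \<kappa> = gr_single R G (a \<otimes>\<^bsub>R\<^esub> b) (\<sigma> \<otimes> \<rho>) \<kappa>" .
qed (use assms in auto)

lemma single_pow:
  assumes "\<sigma> \<in> carrier G"
  shows "gr_single R G \<one>\<^bsub>R\<^esub> \<sigma> [^]\<^bsub>A\<^esub> (n::nat) = gr_single R G \<one>\<^bsub>R\<^esub> (\<sigma> [^] n)"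
  using assms by (induction n) (auto simp: single_one single_mult)

lemma gr_finsum_apply:
  assumes "finite J" "\<And>j. j \<in> J \<Longrightarrow> f j \<in> carrier A" "\<sigma> \<in> carrier G"
  shows "(\<Oplus>\<^bsub>A\<^esub>j\<in>J. f j) \<sigma> = (\<Oplus>\<^bsub>R\<^esub>j\<in>J. f j \<sigma>)"
  using assms
proof (induction J rule: finite_induct)
  case (insert j J)
  then show ?case by (subst A.finsum_insert) (auto simp: R.finsum_insert gr_add gr_ev)
qed (simp add: gr_zero)

text \<open>Expansion in the basis of group elements. Applied to \<epsilon>, it gives a sum over K
  that can be reindexed by the powers of a generator.\<close>

lemma gr_extend_eq_finsum:
  assumes "H \<subseteq> carrier G" "\<And>\<sigma>. \<sigma> \<in> H \<Longrightarrow> f \<sigma> \<in> carrier R"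
  shows "gr_extend R G H f = (\<Oplus>\<^bsub>A\<^esub>\<sigma>\<in>H. gr_single R G (f \<sigma>) \<sigma>)"
proof (rule gr_eqI)
  have fin: "finite H" using assms finite_G finite_subset by blast
  fix \<rho> assume r: "\<rho> \<in> carrier G"
  have "(\<Oplus>\<^bsub>A\<^esub>\<sigma>\<in>H. gr_single R G (f \<sigma>) \<sigma>) \<rho> = (\<Oplus>\<^bsub>R\<^esub>\<sigma>\<in>H. if \<rho> = \<sigma> then f \<sigma> else \<zero>\<^bsub>R\<^esub>)"
    using fin r assms by (simp add: gr_finsum_apply single_apply)
  also have "\<dots> = gr_extend R G H f \<rho>"
  proof (cases "\<rho> \<in> H")
    case True
    then show ?thesis using fin r assms by (subst R.finsum_singleton) (auto simp: gr_extend_def)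
  next
    case False
    then have "(\<Oplus>\<^bsub>R\<^esub>\<sigma>\<in>H. if \<rho> = \<sigma> then f \<sigma> else \<zero>\<^bsub>R\<^esub>) = (\<Oplus>\<^bsub>R\<^esub>\<sigma>\<in>H. \<zero>\<^bsub>R\<^esub>)"
      using assms by (intro R.finsum_cong') auto
    then show ?thesis using False r by (simp add: gr_extend_def)
  qed
  finally show "gr_extend R G H f \<rho> = (\<Oplus>\<^bsub>A\<^esub>\<sigma>\<in>H. gr_single R G (f \<sigma>) \<sigma>) \<rho>" by simp
next
  show "gr_extend R G H f \<in> carrier A" using assms by (auto simp: gr_carrier gr_extend_def)
  show "(\<Oplus>\<^bsub>A\<^esub>\<sigma>\<in>H. gr_single R G (f \<sigma>) \<sigma>) \<in> carrier A" using assms by (intro A.finsum_closed) auto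
qed

section \<open>Extension by zero from the group ring of a subgroup\<close>

lemma gr_extend_single:
  assumes "subgroup H G" "\<sigma> \<in> H"
  shows "gr_extend R G H (gr_single R (G\<lparr>carrier := H\<rparr>) a \<sigma>) = gr_single R G a \<sigma>"
  using assms by (auto simp: gr_extend_def gr_single_def)

lemma finite_group_ring_subgroup:
  assumes "subgroup H G"
  shows "finite_group_ring (G\<lparr>carrier := H\<rparr>) R"
  using assms G.comm_group_subgroup R.cring_axioms finite_G
  by (auto simp: finite_group_ring_def finite_group_ring_axioms_def dest: subgroup.subset finite_subset)

text \<open>In the convolution over G the terms with \<rho> outside H vanish. For \<rho> in H,
  \<rho>^-1 \<sigma> lies in H exactly when \<sigma> does, so the remaining sum is the convolution
  in R[H] at \<sigma> in H and zero at all other \<sigma>.\<close>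

lemma gr_extend_hom:
  assumes H: "subgroup H G"
  shows "ring_hom_cring (group_ring R (G\<lparr>carrier := H\<rparr>)) A (gr_extend R G H)"
proof -
  interpret H: finite_group_ring "G\<lparr>carrier := H\<rparr>" R using H by (rule finite_group_ring_subgroup)
  note sub = subgroup.subset[OF H]
  have fin: "finite H" using sub finite_G finite_subset by blast
  have cl: "gr_extend R G H a \<in> carrier A" if "a \<in> carrier H.A" for a
    using that by (auto simp: gr_carrier H.gr_carrier gr_extend_def)
  show ?thesis
  proof (unfold_locales, rule ring_hom_memI)
    fix a b assume a: "a \<in> carrier H.A" and b: "b \<in> carrier H.A"
    show "gr_extend R G H (a \<oplus>\<^bsub>H.A\<^esub> b) = gr_extend R G H a \<oplus>\<^bsub>A\<^esub> gr_extend R G H b"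
      using a b by (intro gr_eqI cl A.a_closed H.A.a_closed) (auto simp: gr_add H.gr_add gr_extend_def)
    show "gr_extend R G H (a \<otimes>\<^bsub>H.A\<^esub> b) = gr_extend R G H a \<otimes>\<^bsub>A\<^esub> gr_extend R G H b"
    proof (intro gr_eqI cl A.m_closed H.A.m_closed a b)
      fix \<sigma> assume s: "\<sigma> \<in> carrier G"
      have iff: "inv \<rho> \<otimes> \<sigma> \<in> H \<longleftrightarrow> \<sigma> \<in> H" if "\<rho> \<in> H" for \<rho>
      proof
        assume "inv \<rho> \<otimes> \<sigma> \<in> H"
        then have "\<rho> \<otimes> (inv \<rho> \<otimes> \<sigma>) \<in> H" using H that by (simp add: subgroup.m_closed)
        then show "\<sigma> \<in> H" using that s sub by (auto simp: G.m_assoc[symmetric] subset_iff)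
      qed (use H that in \<open>auto intro: subgroup.m_closed subgroup.m_inv_closed\<close>)
      have ext: "gr_extend R G H a \<sigma> \<in> carrier R" "gr_extend R G H b \<sigma> \<in> carrier R"
        if "\<sigma> \<in> carrier G" for \<sigma> using a b cl gr_ev that by auto
      have "(gr_extend R G H a \<otimes>\<^bsub>A\<^esub> gr_extend R G H b) \<sigma> =
         (\<Oplus>\<^bsub>R\<^esub>\<rho>\<in>H. gr_extend R G H a \<rho> \<otimes>\<^bsub>R\<^esub> gr_extend R G H b (inv \<rho> \<otimes> \<sigma>))"
        unfolding gr_mult[OF s]
        by (intro R.add.finprod_mono_neutral_cong_right)
          (use finite_G sub s ext in \<open>auto simp: gr_extend_def\<close>)
      also have "\<dots> = gr_extend R G H (a \<otimes>\<^bsub>H.A\<^esub> b) \<sigma>"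
      proof (cases "\<sigma> \<in> H")
        case True
        then have "gr_extend R G H (a \<otimes>\<^bsub>H.A\<^esub> b) \<sigma> =
            (\<Oplus>\<^bsub>R\<^esub>\<rho>\<in>H. a \<rho> \<otimes>\<^bsub>R\<^esub> b (inv\<^bsub>G\<lparr>carrier := H\<rparr>\<^esub> \<rho> \<otimes> \<sigma>))"
          using s H.gr_mult[of \<sigma> a b] by (simp add: gr_extend_def)
        also have "\<dots> = (\<Oplus>\<^bsub>R\<^esub>\<rho>\<in>H. gr_extend R G H a \<rho> \<otimes>\<^bsub>R\<^esub> gr_extend R G H b (inv \<rho> \<otimes> \<sigma>))"
          using True H s sub iff H.gr_ev[OF a] H.gr_ev[OF b]
          by (intro R.finsum_cong') (auto simp: gr_extend_def G.m_inv_consistent subset_iff)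
        finally show ?thesis ..
      next
        case False
        then have "(\<Oplus>\<^bsub>R\<^esub>\<rho>\<in>H. gr_extend R G H a \<rho> \<otimes>\<^bsub>R\<^esub> gr_extend R G H b (inv \<rho> \<otimes> \<sigma>)) = (\<Oplus>\<^bsub>R\<^esub>\<rho>\<in>H. \<zero>\<^bsub>R\<^esub>)"
          using iff s sub H.gr_ev[OF a] by (intro R.finsum_cong') (auto simp: gr_extend_def subset_iff)
        then show ?thesis using False s by (simp add: gr_extend_def)
      qed
      finally show "gr_extend R G H (a \<otimes>\<^bsub>H.A\<^esub> b) \<sigma> = (gr_extend R G H a \<otimes>\<^bsub>A\<^esub> gr_extend R G H b) \<sigma>" ..
    qed
  next
    show "gr_extend R G H \<one>\<^bsub>H.A\<^esub> = \<one>\<^bsub>A\<^esub>"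
      using gr_extend_single[OF H subgroup.one_closed[OF H], of "\<one>\<^bsub>R\<^esub>"]
      by (simp add: H.single_one[symmetric] single_one[symmetric])
  qed (rule cl)
qed

end

section \<open>Orders of quotients and submodules\<close>

text \<open>Lagrange's theorem for S/E in G/E, for E in G and for E in S. The product form avoids
  division of natural numbers; it later converts the order of a Tate group modulo its S-part into a
  ratio of orders of submodules.\<close>

lemma (in comm_group) order_Mod_Mod:
  assumes S: "subgroup S G" and E: "subgroup E G" and ES: "E \<subseteq> S"
  shows "Coset.order ((G Mod E) Mod carrier (G\<lparr>carrier := S\<rparr> Mod E)) * card S = Coset.order G"
proof -
  let ?Q = "G Mod E" and ?T = "carrier (G\<lparr>carrier := S\<rparr> Mod E)"
  interpret N: normal E G using E subgroup_imp_normal by blast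
  interpret Q: group ?Q by (rule N.factorgroup_is_group)
  interpret S: comm_group "G\<lparr>carrier := S\<rparr>" using S by (rule comm_group_subgroup)
  have ES': "subgroup E (G\<lparr>carrier := S\<rparr>)" using E S ES by (rule subgroup_incl)
  \<comment> \<open>A coset of E by an element of S is the same set in S and in G, so S/E is the
    image of S under the quotient map of G.\<close>
  have T: "?T = (\<lambda>x. E #> x) ` S"
    by (auto simp: FactGroup_def RCOSETS_def r_coset_def)
  interpret h: group_hom G ?Q "\<lambda>x. E #> x"
    using N.r_coset_hom_Mod by unfold_locales
  have sub: "subgroup ?T ?Q" unfolding T by (rule h.subgroup_img_is_subgroup[OF S])
  have 1: "card (rcosets\<^bsub>?Q\<^esub> ?T) * card ?T = Coset.order ?Q"
    using Q.lagrange[OF sub] .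
  have 2: "Coset.order ?Q * card E = Coset.order G"
    using lagrange[OF E] by (simp add: FactGroup_def Coset.order_def)
  have 3: "card ?T * card E = card S"
    using S.lagrange[OF ES'] by (simp add: FactGroup_def Coset.order_def)
  have "Coset.order (?Q Mod ?T) * card S = card (rcosets\<^bsub>?Q\<^esub> ?T) * card ?T * card E"
    by (simp add: Coset.order_def FactGroup_def 3[symmetric])
  then show ?thesis using 1 2 by simp
qed

lemma ivl_insert: "(j::nat) < m \<Longrightarrow> {j..<m} = insert j {Suc j..<m}"
  by auto

lemma (in group_hom) card_image_times_card_kernel:
  "card (h ` carrier G) * card (kernel G H h) = Coset.order G"
proof -
  \<comment> \<open>The target is cut down to the image, where \<open>h\<close> is onto and the
    first isomorphism theorem applies; the kernel stays the same.\<close>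
  interpret I: group "H\<lparr>carrier := h ` carrier G\<rparr>"
    using img_is_subgroup H.subgroup_imp_group by blast
  interpret h: group_hom G "H\<lparr>carrier := h ` carrier G\<rparr>" h
    by unfold_locales (auto simp: hom_def)
  have ker: "kernel G (H\<lparr>carrier := h ` carrier G\<rparr>) h = kernel G H h"
    by (simp add: kernel_def)
  have "card (rcosets (kernel G H h)) = card (h ` carrier G)"
    using iso_same_card[OF h.FactGroup_iso] ker by (simp add: FactGroup_def)
  then show ?thesis using G.lagrange[OF subgroup_kernel] by simp
qed

section \<open>Counting in a finite module along a chain of images\<close>

context module
begin

lemma smult_add_hom: "a \<in> carrier R \<Longrightarrow> group_hom (add_monoid M) (add_monoid M) (\<lambda>x. a \<odot>\<^bsub>M\<^esub> x)"
  by (intro group_hom.intro group_hom_axioms.intro M.a_group) (auto simp: hom_def smult_r_distr)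

lemma subgroup_smult_image:
  assumes "a \<in> carrier R" "subgroup N (add_monoid M)"
  shows "subgroup ((\<lambda>x. a \<odot>\<^bsub>M\<^esub> x) ` N) (add_monoid M)"
  using group_hom.subgroup_img_is_subgroup[OF smult_add_hom] assms by blast

lemma card_smult_image_times_card_annihilated:
  assumes a: "a \<in> carrier R" and N: "subgroup N (add_monoid M)"
  shows "card ((\<lambda>x. a \<odot>\<^bsub>M\<^esub> x) ` N) * card {x \<in> N. a \<odot>\<^bsub>M\<^esub> x = \<zero>\<^bsub>M\<^esub>} = card N"
proof -
  have "group_hom (add_monoid M\<lparr>carrier := N\<rparr>) (add_monoid M) (\<lambda>x. a \<odot>\<^bsub>M\<^esub> x)"
    using subgroup.subset[OF N]
    by (intro group_hom.intro group_hom_axioms.intro M.a_group group.subgroup_imp_group[OF M.a_group N])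
      (auto simp: hom_def smult_r_distr a subset_iff)
  from group_hom.card_image_times_card_kernel[OF this] show ?thesis
    by (simp add: kernel_def Coset.order_def)
qed

text \<open>Multiplication by \<open>b j\<close> maps F (j+1) onto F j, so the ratio of their orders
  is the order of the kernel on F (j+1). The ratios multiply along the chain from F m = N, where the
  product is empty, down to F 0 = 0.\<close>

lemma card_submodule_eq_prod_annihilated:
  assumes N: "subgroup N (add_monoid M)" and fin: "finite N"
    and b: "\<And>j. j < m \<Longrightarrow> b j \<in> carrier R"
    and null: "\<And>x. x \<in> N \<Longrightarrow> (\<Otimes>j\<in>{..<m}. b j) \<odot>\<^bsub>M\<^esub> x = \<zero>\<^bsub>M\<^esub>"
  shows "card N = (\<Prod>j<m. card {x \<in> (\<lambda>x. (\<Otimes>i\<in>{Suc j..<m}. b i) \<odot>\<^bsub>M\<^esub> x) ` N. b j \<odot>\<^bsub>M\<^esub> x = \<zero>\<^bsub>M\<^esub>})"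
proof -
  define F where "F j = (\<lambda>x. (\<Otimes>i\<in>{j..<m}. b i) \<odot>\<^bsub>M\<^esub> x) ` N" for j
  let ?c = "\<lambda>j. card {x \<in> F (Suc j). b j \<odot>\<^bsub>M\<^esub> x = \<zero>\<^bsub>M\<^esub>}"
  have sub: "N \<subseteq> carrier M" using subgroup.subset[OF N] by simp
  have P: "(\<Otimes>i\<in>{j..<m}. b i) \<in> carrier R" for j using b by (intro R.finprod_closed) auto
  have step: "card (F j) * ?c j = card (F (Suc j))" if j: "j < m" for j
  proof -
    have "(\<Otimes>i\<in>{j..<m}. b i) = b j \<otimes> (\<Otimes>i\<in>{Suc j..<m}. b i)"
      unfolding ivl_insert[OF j] using b j by (intro R.finprod_insert) auto
    then have "F j = (\<lambda>x. b j \<odot>\<^bsub>M\<^esub> x) ` F (Suc j)"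
      using sub P b[OF j] by (force simp: F_def image_image smult_assoc1 intro!: image_cong)
    then show ?thesis
      using card_smult_image_times_card_annihilated[OF b[OF j] subgroup_smult_image[OF P N]]
      by (simp add: F_def)
  qed
  \<comment> \<open>Here k counts the steps taken down from the top of the chain; k = m reaches F
    0.\<close>
  have "card N = card (F (m - k)) * (\<Prod>j\<in>{m - k..<m}. ?c j)" if "k \<le> m" for k
    using that
  proof (induction k)
    case 0
    have "F m = N" using sub by (auto simp: F_def image_iff subset_iff)
    then show ?case by simp
  next
    case (Suc k)
    define j where "j = m - Suc k"
    have j: "m - k = Suc j" "j < m" using Suc.prems by (auto simp: j_def)
    have "card N = card (F (Suc j)) * (\<Prod>j\<in>{Suc j..<m}. ?c j)" using Suc j by simp
    also have "\<dots> = card (F j) * (\<Prod>j\<in>{j..<m}. ?c j)"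
      using j by (simp add: step[symmetric] prod.atLeast_Suc_lessThan)
    finally show ?case by (simp add: j_def)
  qed
  from this[of m] have "card N = card (F 0) * (\<Prod>j\<in>{0..<m}. ?c j)" by simp
  moreover have "F 0 = {\<zero>\<^bsub>M\<^esub>}"
    using null subgroup.one_closed[OF N] by (auto simp: F_def atLeast0LessThan image_iff)
  ultimately show ?thesis by (simp add: F_def atLeast0LessThan)
qed

end

section \<open>Characters\<close>

lemma characters_memD:
  assumes "\<chi> \<in> characters e \<Gamma>"
  shows "\<And>\<sigma>. \<sigma> \<in> carrier \<Gamma> \<Longrightarrow> \<chi> \<sigma> ^ e = 1"
    and "\<And>\<sigma> \<rho>. \<sigma> \<in> carrier \<Gamma> \<Longrightarrow> \<rho> \<in> carrier \<Gamma> \<Longrightarrow> \<chi> (\<sigma> \<otimes>\<^bsub>\<Gamma>\<^esub> \<rho>) = \<chi> \<sigma> * \<chi> \<rho>"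
    and "\<chi> \<in> extensional (carrier \<Gamma>)"
  using assms by (auto simp: characters_def hom_def roots_of_unity_def Pi_def)

lemma charactersI:
  assumes "\<And>\<sigma>. \<sigma> \<in> carrier \<Gamma> \<Longrightarrow> \<chi> \<sigma> ^ e = 1"
    and "\<And>\<sigma> \<rho>. \<sigma> \<in> carrier \<Gamma> \<Longrightarrow> \<rho> \<in> carrier \<Gamma> \<Longrightarrow> \<chi> (\<sigma> \<otimes>\<^bsub>\<Gamma>\<^esub> \<rho>) = \<chi> \<sigma> * \<chi> \<rho>"
    and "\<chi> \<in> extensional (carrier \<Gamma>)"
  shows "\<chi> \<in> characters e \<Gamma>"
  using assms by (auto simp: characters_def hom_def roots_of_unity_def)

context group
begin

lemma character_nonzero: "\<chi> \<in> characters e G \<Longrightarrow> e > 0 \<Longrightarrow> \<sigma> \<in> carrier G \<Longrightarrow> \<chi> \<sigma> \<noteq> 0"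
  using characters_memD(1)[of \<chi> e G \<sigma>] by (auto simp: power_0_left)

text \<open>\<open>hom\<close> demands only multiplicativity, so the value at the identity is
  derived: it is idempotent and nonzero.\<close>

lemma character_one: "\<chi> \<in> characters e G \<Longrightarrow> e > 0 \<Longrightarrow> \<chi> \<one> = 1"
  using characters_memD(2)[of \<chi> e G \<one> \<one>] character_nonzero[of \<chi> e \<one>] by simp

lemma character_pow:
  assumes "\<chi> \<in> characters e G" "e > 0" "\<sigma> \<in> carrier G"
  shows "\<chi> (\<sigma> [^] (n::nat)) = \<chi> \<sigma> ^ n"
  using assms by (induction n) (auto simp: character_one characters_memD(2)[OF assms(1)])

end

section \<open>Characters of a finite cyclic group\<close>

locale cyclic_group_characters = comm_group G for G (structure) +
  fixes \<tau> :: 'a and e :: nat and \<zeta> :: complex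
  assumes finite_carrier: "finite (carrier G)"
    and gen_closed: "\<tau> \<in> carrier G" and gen: "generate G {\<tau>} = carrier G"
    and root: "primitive_root_of_unity e \<zeta>" and order_dvd: "Coset.order G dvd e"
begin

abbreviation "m \<equiv> Coset.order G"
abbreviation "z \<equiv> cyc_root e \<zeta> G"

lemma root_z: "primitive_root_of_unity m z"
  unfolding cyc_root_def by (rule primitive_root_of_unity_power[OF root order_dvd])

lemma e_pos: "e > 0" using root by (simp add: primitive_root_of_unity_def)

lemma ord_gen: "ord \<tau> = m"
  using generate_pow_card[OF gen_closed] gen by (simp add: Coset.order_def)

lemma m_pos: "m > 0" using root_z by (simp add: primitive_root_of_unity_def)

lemma gen_pow_eq_iff: "\<tau> [^] (a::nat) = \<tau> [^] (b::nat) \<longleftrightarrow> a mod m = b mod m"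
  using int_pow_eq[OF gen_closed, of "int a" "int b"] ord_gen
  by (simp add: int_pow_int) (metis mod_eq_dvd_iff of_nat_eq_iff zmod_int)

lemma bij_gen_pow: "bij_betw (\<lambda>a::nat. \<tau> [^] a) {..<m} (carrier G)"
proof -
  have "inj_on (\<lambda>a::nat. \<tau> [^] a) {..<m}" by (auto simp: inj_on_def gen_pow_eq_iff)
  moreover have "(\<lambda>a::nat. \<tau> [^] a) ` {..<m} = carrier G"
  proof (rule card_subset_eq)
    show "card ((\<lambda>a::nat. \<tau> [^] a) ` {..<m}) = card (carrier G)"
      using card_image[OF calculation] by (simp add: Coset.order_def)
  qed (use gen_closed finite_carrier in auto)
  ultimately show ?thesis by (simp add: bij_betw_def)
qed

lemma carrier_gen_powE:
  assumes "\<sigma> \<in> carrier G"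
  obtains a :: nat where "a < m" "\<sigma> = \<tau> [^] a"
  using bij_gen_pow assms by (auto simp: bij_betw_def)

lemma character_gen_pow_order: "\<chi> \<in> characters e G \<Longrightarrow> \<chi> \<tau> ^ m = 1"
  using character_pow[of \<chi> e \<tau> m] character_one[of \<chi> e] gen_closed e_pos pow_order_eq_1 by auto

lemma characters_eqI:
  assumes "\<chi> \<in> characters e G" "\<chi>' \<in> characters e G" "\<chi> \<tau> = \<chi>' \<tau>"
  shows "\<chi> = \<chi>'"
proof (rule extensionalityI)
  fix \<sigma> assume "\<sigma> \<in> carrier G"
  then obtain a :: nat where "\<sigma> = \<tau> [^] a" by (rule carrier_gen_powE)
  then show "\<chi> \<sigma> = \<chi>' \<sigma>"
    using assms e_pos gen_closed by (simp add: character_pow)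
qed (use characters_memD(3) assms in auto)

text \<open>The character sends \<tau>^a to w^a. The defining description picks the exponent below
  m, and w^m = 1 makes the value independent of the exponent; as m divides e, the values are e-th
  roots of unity.\<close>

lemma character_exists:
  assumes w: "w ^ m = 1"
  shows "\<exists>\<chi>\<in>characters e G. \<chi> \<tau> = w"
proof -
  have wmod: "w ^ (a mod m) = w ^ a" for a
  proof -
    have "w ^ a = w ^ (m * (a div m) + a mod m)" by simp
    also have "\<dots> = w ^ (a mod m)" by (simp only: power_add power_mult w) simp
    finally show ?thesis ..
  qed
  define \<chi> where "\<chi> = (\<lambda>\<sigma>\<in>carrier G. w ^ (THE a. a < m \<and> \<sigma> = \<tau> [^] a))"
  have val: "\<chi> (\<tau> [^] a) = w ^ a" for a :: nat
  proof -
    have "(THE b. b < m \<and> \<tau> [^] a = \<tau> [^] b) = a mod m"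
      using m_pos by (intro the_equality) (auto simp: gen_pow_eq_iff)
    then show ?thesis using gen_closed by (simp add: \<chi>_def wmod)
  qed
  have "\<chi> \<in> characters e G"
  proof (rule charactersI)
    fix \<sigma> assume "\<sigma> \<in> carrier G"
    then obtain a :: nat where a: "\<sigma> = \<tau> [^] a" by (rule carrier_gen_powE)
    have "w ^ e = 1" using order_dvd w by (auto simp: dvd_def power_mult)
    then show "\<chi> \<sigma> ^ e = 1" unfolding a val by (metis mult.commute power_mult power_one)
    fix \<rho> assume "\<rho> \<in> carrier G"
    then obtain b :: nat where b: "\<rho> = \<tau> [^] b" by (rule carrier_gen_powE)
    show "\<chi> (\<sigma> \<otimes> \<rho>) = \<chi> \<sigma> * \<chi> \<rho>"
      using gen_closed by (simp add: a b nat_pow_mult val power_add)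
  qed (simp add: \<chi>_def)
  moreover have "\<chi> \<tau> = w" using val[of 1] gen_closed by simp
  ultimately show ?thesis by blast
qed

lemma cyc_char: "cyc_char e \<zeta> G \<tau> \<in> characters e G" "cyc_char e \<zeta> G \<tau> \<tau> = z"
proof -
  have "z ^ m = 1" using root_z by (simp add: primitive_root_of_unity_def)
  then have "\<exists>!\<xi>. \<xi> \<in> characters e G \<and> \<xi> \<tau> = z"
    using character_exists characters_eqI by metis
  from theI'[OF this] show "cyc_char e \<zeta> G \<tau> \<in> characters e G" "cyc_char e \<zeta> G \<tau> \<tau> = z"
    by (auto simp: cyc_char_def)
qed

lemma char_index_eqI:
  assumes \<chi>: "\<chi> \<in> characters e G" and k: "k < m" "\<chi> \<tau> = z ^ k"
  shows "char_index e \<zeta> G \<tau> \<chi> = k"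
  unfolding char_index_def
proof (rule the_equality)
  have "(\<lambda>\<sigma>\<in>carrier G. cyc_char e \<zeta> G \<tau> \<sigma> ^ k) \<in> characters e G"
    using characters_memD[OF cyc_char(1)]
    by (intro charactersI) (auto simp: power_mult_distrib, metis mult.commute power_mult power_one)
  then show "k < m \<and> \<chi> = (\<lambda>\<sigma>\<in>carrier G. cyc_char e \<zeta> G \<tau> \<sigma> ^ k)"
    using k by (auto intro!: characters_eqI[OF \<chi>] simp: gen_closed cyc_char(2))
next
  fix k' assume "k' < m \<and> \<chi> = (\<lambda>\<sigma>\<in>carrier G. cyc_char e \<zeta> G \<tau> \<sigma> ^ k')"
  then have "k' < m" "z ^ k' = z ^ k" using gen_closed k by (auto simp: cyc_char(2))
  then show "k' = k"
    using primitive_root_of_unity_powers[OF root_z] k(1) by (auto simp: bij_betw_def inj_on_def)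
qed

lemma char_index:
  assumes "\<chi> \<in> characters e G"
  shows "char_index e \<zeta> G \<tau> \<chi> < m" "\<chi> \<tau> = z ^ char_index e \<zeta> G \<tau> \<chi>"
proof -
  obtain k where k: "k < m" "\<chi> \<tau> = z ^ k"
    using primitive_root_of_unity_powers[OF root_z] character_gen_pow_order[OF assms]
    by (auto simp: bij_betw_def)
  with char_index_eqI[OF assms k]
  show "char_index e \<zeta> G \<tau> \<chi> < m" "\<chi> \<tau> = z ^ char_index e \<zeta> G \<tau> \<chi>" by simp_all
qed

text \<open>A character is determined by its value at \<tau>, and every power z^k with k < m occurs.
  Products over characters thus become products over exponents, which also index the chain of
  submodules.\<close>

lemma bij_char_index: "bij_betw (char_index e \<zeta> G \<tau>) (characters e G) {..<m}"
proof (rule bij_betwI')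
  fix \<chi> \<chi>' assume *: "\<chi> \<in> characters e G" "\<chi>' \<in> characters e G"
  show "char_index e \<zeta> G \<tau> \<chi> = char_index e \<zeta> G \<tau> \<chi>' \<longleftrightarrow> \<chi> = \<chi>'"
    using * characters_eqI char_index(2) by metis
next
  fix k assume "k \<in> {..<m}"
  moreover have "(z ^ k) ^ m = 1"
    using root_z by (metis primitive_root_of_unity_def mult.commute power_mult power_one)
  then obtain \<chi> where "\<chi> \<in> characters e G" "\<chi> \<tau> = z ^ k" using character_exists by blast
  ultimately show "\<exists>\<chi>\<in>characters e G. k = char_index e \<zeta> G \<tau> \<chi>"
    using char_index_eqI by force
qed (use char_index in auto)

end

text \<open>As H and K meet trivially, an element of HK has only one factorization h k. Characters
  \<psi> of H and \<chi> of K therefore glue to \<theta>(h k) = \<psi>(h) \<chi>(k), and restriction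
  recovers both.\<close>

lemma (in comm_group) bij_characters_internal_product:
  assumes H: "subgroup H G" and K: "subgroup K G" and HK: "H \<inter> K = {\<one>}" and e: "e > 0"
  shows "bij_betw (\<lambda>\<theta>. (restrict \<theta> H, restrict \<theta> K)) (characters e (G\<lparr>carrier := H <#> K\<rparr>))
    (characters e (G\<lparr>carrier := H\<rparr>) \<times> characters e (G\<lparr>carrier := K\<rparr>))"
proof -
  have Hc: "h \<in> carrier G" if "h \<in> H" for h using that H by (rule subgroup.mem_carrier[rotated])
  have Kc: "k \<in> carrier G" if "k \<in> K" for k using that K by (rule subgroup.mem_carrier[rotated])
  note [simp] = subgroup.one_closed[OF H] subgroup.one_closed[OF K]
  have L: "x \<in> H <#> K \<longleftrightarrow> (\<exists>h\<in>H. \<exists>k\<in>K. x = h \<otimes> k)" for x by (auto simp: set_mult_def)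
  have HL: "h \<in> H <#> K" if "h \<in> H" for h unfolding L using that Hc by (intro bexI[of _ h] bexI[of _ \<one>]) auto
  have KL: "k \<in> H <#> K" if "k \<in> K" for k unfolding L using that Kc by (intro bexI[of _ \<one>] bexI[of _ k]) auto
  have uniq: "h = h' \<and> k = k'" if "h \<in> H" "h' \<in> H" "k \<in> K" "k' \<in> K" "h \<otimes> k = h' \<otimes> k'" for h h' k k'
  proof -
    have "inv h' \<otimes> h = inv h' \<otimes> (h \<otimes> k) \<otimes> inv k" using that(1-4) Hc Kc by (simp add: m_assoc)
    also have "\<dots> = inv h' \<otimes> (h' \<otimes> k') \<otimes> inv k" by (simp only: that(5))
    also have "\<dots> = k' \<otimes> inv k" using that(1-4) Hc Kc by (simp add: m_assoc[symmetric])
    finally have "inv h' \<otimes> h = k' \<otimes> inv k" .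
    moreover have "inv h' \<otimes> h \<in> H"
      by (rule subgroup.m_closed[OF H subgroup.m_inv_closed[OF H that(2)] that(1)])
    moreover have "k' \<otimes> inv k \<in> K"
      by (rule subgroup.m_closed[OF K that(4) subgroup.m_inv_closed[OF K that(3)]])
    ultimately have "inv h' \<otimes> h \<in> H \<inter> K" by simp
    then have "inv h' \<otimes> h = \<one>" unfolding HK by simp
    then have "h' \<otimes> (inv h' \<otimes> h) = h' \<otimes> \<one>" by (simp only:)
    then have "h = h'" using Hc[OF that(1)] Hc[OF that(2)] by (simp add: m_assoc[symmetric])
    moreover have "k = k'"
      using that(5) Hc[OF that(2)] Kc[OF that(3)] Kc[OF that(4)] l_cancel unfolding \<open>h = h'\<close> by blast
    ultimately show ?thesis by simp
  qed
  have exch: "(h \<otimes> k) \<otimes> (h' \<otimes> k') = (h \<otimes> h') \<otimes> (k \<otimes> k')" if "h \<in> H" "h' \<in> H" "k \<in> K" "k' \<in> K" for h h' k k'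
    using that Hc Kc by (simp add: m_ac)
  show ?thesis
  proof (rule bij_betwI')
    fix \<theta> \<theta>' assume *: "\<theta> \<in> characters e (G\<lparr>carrier := H <#> K\<rparr>)" "\<theta>' \<in> characters e (G\<lparr>carrier := H <#> K\<rparr>)"
    show "(restrict \<theta> H, restrict \<theta> K) = (restrict \<theta>' H, restrict \<theta>' K) \<longleftrightarrow> \<theta> = \<theta>'"
    proof
      assume "(restrict \<theta> H, restrict \<theta> K) = (restrict \<theta>' H, restrict \<theta>' K)"
      then have r: "restrict \<theta> H = restrict \<theta>' H" "restrict \<theta> K = restrict \<theta>' K" by auto
      have eq: "\<theta> h = \<theta>' h" if "h \<in> H" for h using fun_cong[OF r(1), of h] that by simp
      have eq': "\<theta> k = \<theta>' k" if "k \<in> K" for k using fun_cong[OF r(2), of k] that by simp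
      show "\<theta> = \<theta>'"
      proof (rule extensionalityI)
        fix x assume "x \<in> H <#> K"
        then obtain h k where hk: "h \<in> H" "k \<in> K" "x = h \<otimes> k" by (auto simp: L)
        then show "\<theta> x = \<theta>' x"
          using characters_memD(2)[OF *(1), of h k] characters_memD(2)[OF *(2), of h k] eq eq' HL KL by simp
      qed (use characters_memD(3)[OF *(1)] characters_memD(3)[OF *(2)] in auto)
    qed simp
  next
    fix \<theta> assume *: "\<theta> \<in> characters e (G\<lparr>carrier := H <#> K\<rparr>)"
    show "(restrict \<theta> H, restrict \<theta> K) \<in> characters e (G\<lparr>carrier := H\<rparr>) \<times> characters e (G\<lparr>carrier := K\<rparr>)"
      using characters_memD[OF *] HL KL subgroup.m_closed[OF H] subgroup.m_closed[OF K]
      by (auto intro!: charactersI)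
  next
    fix p assume "p \<in> characters e (G\<lparr>carrier := H\<rparr>) \<times> characters e (G\<lparr>carrier := K\<rparr>)"
    then obtain \<psi> \<chi> where p: "p = (\<psi>, \<chi>)" and psi: "\<psi> \<in> characters e (G\<lparr>carrier := H\<rparr>)"
      and chi: "\<chi> \<in> characters e (G\<lparr>carrier := K\<rparr>)" by auto
    interpret H: group "G\<lparr>carrier := H\<rparr>" using H by (rule subgroup_imp_group)
    interpret K: group "G\<lparr>carrier := K\<rparr>" using K by (rule subgroup_imp_group)
    have one: "\<psi> \<one> = 1" "\<chi> \<one> = 1"
      using H.character_one[OF psi e] K.character_one[OF chi e] by simp_all
    \<comment> \<open>The description is well defined by \<open>uniq\<close>.\<close>
    define \<theta> where "\<theta> = (\<lambda>x\<in>H <#> K. THE w. \<exists>h\<in>H. \<exists>k\<in>K. x = h \<otimes> k \<and> w = \<psi> h * \<chi> k)"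
    have val: "\<theta> (h \<otimes> k) = \<psi> h * \<chi> k" if "h \<in> H" "k \<in> K" for h k
    proof -
      have "(THE w. \<exists>h'\<in>H. \<exists>k'\<in>K. h \<otimes> k = h' \<otimes> k' \<and> w = \<psi> h' * \<chi> k') = \<psi> h * \<chi> k"
      proof (rule the_equality)
        fix w assume "\<exists>h'\<in>H. \<exists>k'\<in>K. h \<otimes> k = h' \<otimes> k' \<and> w = \<psi> h' * \<chi> k'"
        then obtain h' k' where "h' \<in> H" "k' \<in> K" "h \<otimes> k = h' \<otimes> k'" "w = \<psi> h' * \<chi> k'" by blast
        then show "w = \<psi> h * \<chi> k" using uniq[of h h' k k'] that by simp
      qed (use that in blast)
      then show ?thesis using that by (auto simp: \<theta>_def L)
    qed
    have "\<theta> \<in> characters e (G\<lparr>carrier := H <#> K\<rparr>)"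
    proof (rule charactersI)
      fix x assume "x \<in> carrier (G\<lparr>carrier := H <#> K\<rparr>)"
      then obtain h k where hk: "h \<in> H" "k \<in> K" "x = h \<otimes> k" by (auto simp: L)
      show "\<theta> x ^ e = 1"
        using hk characters_memD(1)[OF psi, of h] characters_memD(1)[OF chi, of k]
        by (simp add: val power_mult_distrib)
      fix y assume "y \<in> carrier (G\<lparr>carrier := H <#> K\<rparr>)"
      then obtain h' k' where hk': "h' \<in> H" "k' \<in> K" "y = h' \<otimes> k'" by (auto simp: L)
      show "\<theta> (x \<otimes>\<^bsub>G\<lparr>carrier := H <#> K\<rparr>\<^esub> y) = \<theta> x * \<theta> y"
        using hk hk' characters_memD(2)[OF psi, of h h'] characters_memD(2)[OF chi, of k k']
        by (simp add: exch val subgroup.m_closed[OF H] subgroup.m_closed[OF K])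
    qed (simp add: \<theta>_def)
    moreover have "restrict \<theta> H = \<psi>"
      using characters_memD(3)[OF psi] val[of _ \<one>] Hc one
      by (intro extensionalityI[of _ H]) auto
    moreover have "restrict \<theta> K = \<chi>"
      using characters_memD(3)[OF chi] val[of \<one>] Kc one
      by (intro extensionalityI[of _ K]) auto
    ultimately show "\<exists>\<theta>\<in>characters e (G\<lparr>carrier := H <#> K\<rparr>). p = (restrict \<theta> H, restrict \<theta> K)"
      using p by blast
  qed
qed

section \<open>Isotypic parts\<close>

lemma int_adjoin_closed:
  fixes \<zeta> :: complex
  defines "Z \<equiv> carrier (int_adjoin \<zeta>)"
  shows "\<zeta> \<in> Z" "1 \<in> Z" "0 \<in> Z"
    and "x \<in> Z \<Longrightarrow> y \<in> Z \<Longrightarrow> x + y \<in> Z"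
    and "x \<in> Z \<Longrightarrow> y \<in> Z \<Longrightarrow> x * y \<in> Z"
    and "x \<in> Z \<Longrightarrow> - x \<in> Z"
proof -
  let ?C = "ring_of_type_algebra :: complex ring"
  interpret C: cring ?C by (rule cring_from_type_algebra)
  have Z: "Z = generate_ring ?C {\<zeta>}" by (simp add: Z_def int_adjoin_def)
  have ops: "\<one>\<^bsub>?C\<^esub> = 1" "\<And>x y. x \<oplus>\<^bsub>?C\<^esub> y = x + y" "\<And>x y. x \<otimes>\<^bsub>?C\<^esub> y = x * y" "carrier ?C = UNIV"
      "\<zero>\<^bsub>?C\<^esub> = 0"
    by (simp_all add: ring_of_type_algebra_def)
  have minus: "\<ominus>\<^bsub>?C\<^esub> x = - x" for x by (rule C.minus_equality) (simp_all add: ops)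
  show "\<zeta> \<in> Z" unfolding Z by (rule generate_ring.incl) simp
  show "1 \<in> Z" using generate_ring.one[of ?C "{\<zeta>}"] by (simp add: Z ops)
  show "0 \<in> Z" using C.zero_in_generate[of "{\<zeta>}"] by (simp add: Z ops)
  show "x + y \<in> Z" if "x \<in> Z" "y \<in> Z"
    using generate_ring.eng_add[of x ?C "{\<zeta>}" y] that by (simp add: Z ops)
  show "x * y \<in> Z" if "x \<in> Z" "y \<in> Z"
    using generate_ring.eng_mult[of x ?C "{\<zeta>}" y] that by (simp add: Z ops)
  show "- x \<in> Z" if "x \<in> Z"
    using generate_ring.a_inv[of x ?C "{\<zeta>}"] that by (simp add: Z minus)
qed

lemma int_adjoin_ops:
  "\<one>\<^bsub>int_adjoin \<zeta>\<^esub> = 1" "x \<oplus>\<^bsub>int_adjoin \<zeta>\<^esub> y = x + y" "x \<otimes>\<^bsub>int_adjoin \<zeta>\<^esub> y = x * y"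
  by (simp_all add: int_adjoin_def ring_of_type_algebra_def)

lemma int_adjoin_power: "x \<in> carrier (int_adjoin \<zeta>) \<Longrightarrow> x ^ n \<in> carrier (int_adjoin \<zeta>)"
  by (induction n) (auto intro: int_adjoin_closed)

text \<open>Every e-th root of unity is a power of \<zeta>. Hence all character values lie in the
  ring on which \<open>\<iota>\<close> is a homomorphism.\<close>

lemma int_adjoin_root_of_unity:
  assumes "primitive_root_of_unity e \<zeta>" "w ^ e = 1"
  shows "w \<in> carrier (int_adjoin \<zeta>)"
proof -
  obtain j where "w = \<zeta> ^ j"
    using primitive_root_of_unity_powers[OF assms(1)] assms(2) by (auto simp: bij_betw_def)
  then show ?thesis using int_adjoin_power int_adjoin_closed(1) by simp
qed

locale group_ring_module = finite_group_ring G R + M: module "group_ring R G" M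
  for G :: "('g, 'x) monoid_scheme" (structure) and R :: "('r, 'y) ring_scheme"
    and M :: "('g \<Rightarrow> 'r, 'm, 'z) module_scheme" +
  fixes \<iota> :: "complex \<Rightarrow> 'r" and e :: nat and \<zeta> :: complex
  assumes finite_M: "finite (carrier M)"
    and root: "primitive_root_of_unity e \<zeta>"
    and \<iota>_hom: "\<iota> \<in> ring_hom (int_adjoin \<zeta>) R"
begin

abbreviation "Z \<equiv> carrier (int_adjoin \<zeta>)"

definition act :: "'g \<Rightarrow> 'g \<Rightarrow> 'r" where "act \<sigma> = gr_single R G \<one>\<^bsub>R\<^esub> \<sigma>"
definition scal :: "complex \<Rightarrow> 'g \<Rightarrow> 'r" where "scal w = gr_single R G (\<iota> w) \<one>"

lemma e_pos: "e > 0" using root by (simp add: primitive_root_of_unity_def)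

lemma \<iota>_closed: "w \<in> Z \<Longrightarrow> \<iota> w \<in> carrier R"
  by (rule ring_hom_closed[OF \<iota>_hom])

lemma \<iota>_add: "w \<in> Z \<Longrightarrow> w' \<in> Z \<Longrightarrow> \<iota> (w + w') = \<iota> w \<oplus>\<^bsub>R\<^esub> \<iota> w'"
  using ring_hom_add[OF \<iota>_hom] by (simp add: int_adjoin_ops)

lemma \<iota>_mult: "w \<in> Z \<Longrightarrow> w' \<in> Z \<Longrightarrow> \<iota> (w * w') = \<iota> w \<otimes>\<^bsub>R\<^esub> \<iota> w'"
  using ring_hom_mult[OF \<iota>_hom] by (simp add: int_adjoin_ops)

lemma \<iota>_one: "\<iota> 1 = \<one>\<^bsub>R\<^esub>"
  using ring_hom_one[OF \<iota>_hom] by (simp add: int_adjoin_ops)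

lemma act_closed [simp]: "act \<sigma> \<in> carrier A"
  by (simp add: act_def)

lemma scal_closed [simp]: "w \<in> Z \<Longrightarrow> scal w \<in> carrier A"
  by (simp add: scal_def \<iota>_closed)

lemma act_mult: "\<sigma> \<in> carrier G \<Longrightarrow> \<rho> \<in> carrier G \<Longrightarrow> act (\<sigma> \<otimes> \<rho>) = act \<sigma> \<otimes>\<^bsub>A\<^esub> act \<rho>"
  by (simp add: act_def single_mult)

lemma act_one: "act \<one> = \<one>\<^bsub>A\<^esub>"
  by (simp add: act_def single_one)

lemma act_pow: "\<sigma> \<in> carrier G \<Longrightarrow> act (\<sigma> [^] (n::nat)) = act \<sigma> [^]\<^bsub>A\<^esub> n"
  by (simp add: act_def single_pow)

lemma scal_mult: "w \<in> Z \<Longrightarrow> w' \<in> Z \<Longrightarrow> scal (w * w') = scal w \<otimes>\<^bsub>A\<^esub> scal w'"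
  by (simp add: scal_def \<iota>_mult single_mult \<iota>_closed)

lemma scal_one: "scal 1 = \<one>\<^bsub>A\<^esub>"
  by (simp add: scal_def \<iota>_one single_one)

lemma scal_act: "w \<in> Z \<Longrightarrow> \<sigma> \<in> carrier G \<Longrightarrow> gr_single R G (\<iota> w) \<sigma> = scal w \<otimes>\<^bsub>A\<^esub> act \<sigma>"
  by (simp add: scal_def act_def single_mult \<iota>_closed)

lemma poly_evaluation_act: "poly_evaluation A Z scal (act \<sigma>)"
  using int_adjoin_closed
  by unfold_locales
    (simp_all add: scal_one scal_mult, simp add: scal_def \<iota>_add single_add \<iota>_closed)

text \<open>Phrased with scalars from R[G] alone, so that isotypic parts for different subgroups are
  subsets of the same module and can be intersected.\<close>

definition isotypic_part :: "'g set \<Rightarrow> ('g \<Rightarrow> complex) \<Rightarrow> 'm set" where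
  "isotypic_part H \<psi> = {x \<in> carrier M. \<forall>\<sigma>\<in>H. act \<sigma> \<odot>\<^bsub>M\<^esub> x = scal (\<psi> \<sigma>) \<odot>\<^bsub>M\<^esub> x}"

lemma gr_restrict_smult: "a \<odot>\<^bsub>gr_restrict R G H M\<^esub> x = gr_extend R G H a \<odot>\<^bsub>M\<^esub> x"
  by (simp add: gr_restrict_def gr_extend_def)

lemma isotypic_gr_restrict:
  assumes "subgroup H G"
  shows "isotypic R \<iota> (G\<lparr>carrier := H\<rparr>) \<psi> (gr_restrict R G H M) = isotypic_part H \<psi>"
  using gr_extend_single[OF assms] subgroup.one_closed[OF assms]
  by (simp add: isotypic_def isotypic_part_def gr_restrict_smult act_def scal_def)
    (simp add: gr_restrict_def)

text \<open>R[K] acts on the \<psi>-part through \<open>gr_extend\<close>, which fixes group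
  elements of K and scalars, so the \<chi>-condition inside the \<psi>-part is the one inside
  M.\<close>

lemma isotypic_isotypic_module:
  assumes "subgroup H G" "subgroup K G"
  shows "isotypic R \<iota> (G\<lparr>carrier := K\<rparr>) \<chi> (isotypic_module R \<iota> G H \<psi> K M) =
    isotypic_part H \<psi> \<inter> isotypic_part K \<chi>"
proof -
  have "a \<odot>\<^bsub>isotypic_module R \<iota> G H \<psi> K M\<^esub> x = gr_extend R G K a \<odot>\<^bsub>M\<^esub> x" for a x
    by (simp add: isotypic_module_def gr_restrict_def gr_extend_def)
  moreover have "carrier (isotypic_module R \<iota> G H \<psi> K M) = isotypic_part H \<psi>"
    using assms(1) by (simp add: isotypic_module_def isotypic_gr_restrict)
  ultimately show ?thesis
    using gr_extend_single[OF assms(2)] subgroup.one_closed[OF assms(2)]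
    by (auto simp add: isotypic_def isotypic_part_def act_def scal_def)
qed

lemma isotypic_eq_isotypic_part: "isotypic R \<iota> G \<chi> M = isotypic_part (carrier G) \<chi>"
  by (simp add: isotypic_def isotypic_part_def act_def scal_def)

text \<open>R[G] is commutative, so each of its elements commutes with the defining conditions.
  Stability under all of R[G] lets the elements \<tau> - z^j of another factor K act on the
  \<psi>-part.\<close>

lemma isotypic_part_submodule:
  assumes H: "subgroup H G" and \<psi>: "\<psi> \<in> characters e (G\<lparr>carrier := H\<rparr>)"
  shows "submodule (isotypic_part H \<psi>) A M"
proof -
  have \<psi>_Z: "scal (\<psi> \<sigma>) \<in> carrier A" if "\<sigma> \<in> H" for \<sigma>
    using characters_memD(1)[OF \<psi>, of \<sigma>] that int_adjoin_root_of_unity[OF root] by simp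
  show ?thesis
  proof (rule M.submoduleI)
    show "\<zero>\<^bsub>M\<^esub> \<in> isotypic_part H \<psi>" using \<psi>_Z by (simp add: isotypic_part_def)
  next
    fix x assume x: "x \<in> isotypic_part H \<psi>"
    then show "\<ominus>\<^bsub>M\<^esub> x \<in> isotypic_part H \<psi>"
      using \<psi>_Z by (simp add: isotypic_part_def M.smult_r_minus)
    fix y assume "y \<in> isotypic_part H \<psi>"
    with x show "x \<oplus>\<^bsub>M\<^esub> y \<in> isotypic_part H \<psi>"
      using \<psi>_Z by (simp add: isotypic_part_def M.smult_r_distr)
  next
    fix a x assume a: "a \<in> carrier A" and x: "x \<in> isotypic_part H \<psi>"
    have "b \<odot>\<^bsub>M\<^esub> (a \<odot>\<^bsub>M\<^esub> x) = a \<odot>\<^bsub>M\<^esub> (b \<odot>\<^bsub>M\<^esub> x)" if "b \<in> carrier A" for b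
      using that a x by (simp add: isotypic_part_def A.m_comm flip: M.smult_assoc1)
    then show "a \<odot>\<^bsub>M\<^esub> x \<in> isotypic_part H \<psi>"
      using a x \<psi>_Z by (simp add: isotypic_part_def)
  qed (simp add: isotypic_part_def)
qed

text \<open>If h and k act on x by \<theta>(h) and \<theta>(k), then h k acts by their product,
  which is \<theta>(h k); the converse is restriction.\<close>

lemma isotypic_part_internal_product:
  assumes H: "subgroup H G" and K: "subgroup K G" and \<theta>: "\<theta> \<in> characters e (G\<lparr>carrier := H <#> K\<rparr>)"
  shows "isotypic_part (H <#> K) \<theta> = isotypic_part H (restrict \<theta> H) \<inter> isotypic_part K (restrict \<theta> K)"
proof -
  have Hc: "h \<in> carrier G" if "h \<in> H" for h using that H by (rule subgroup.mem_carrier[rotated])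
  have Kc: "k \<in> carrier G" if "k \<in> K" for k using that K by (rule subgroup.mem_carrier[rotated])
  have HK: "h \<otimes> k \<in> H <#> K" if "h \<in> H" "k \<in> K" for h k using that by (auto simp: set_mult_def)
  have HL: "h \<in> H <#> K" if "h \<in> H" for h
    using HK[OF that subgroup.one_closed[OF K]] Hc[OF that] by simp
  have KL: "k \<in> H <#> K" if "k \<in> K" for k
    using HK[OF subgroup.one_closed[OF H] that] Kc[OF that] by simp
  have \<theta>_Z: "\<theta> x \<in> Z" if "x \<in> H <#> K" for x
    using characters_memD(1)[OF \<theta>, of x] that int_adjoin_root_of_unity[OF root] by simp
  show ?thesis
  proof (intro equalityI subsetI)
    fix x assume "x \<in> isotypic_part (H <#> K) \<theta>"
    then show "x \<in> isotypic_part H (restrict \<theta> H) \<inter> isotypic_part K (restrict \<theta> K)"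
      using HL KL by (simp add: isotypic_part_def)
  next
    fix x assume x: "x \<in> isotypic_part H (restrict \<theta> H) \<inter> isotypic_part K (restrict \<theta> K)"
    then have xM: "x \<in> carrier M" by (simp add: isotypic_part_def)
    have "act (h \<otimes> k) \<odot>\<^bsub>M\<^esub> x = scal (\<theta> (h \<otimes> k)) \<odot>\<^bsub>M\<^esub> x" if hk: "h \<in> H" "k \<in> K" for h k
    proof -
      have Z: "scal (\<theta> h) \<in> carrier A" "scal (\<theta> k) \<in> carrier A"
        using \<theta>_Z[OF HL[OF hk(1)]] \<theta>_Z[OF KL[OF hk(2)]] by simp_all
      have "act (h \<otimes> k) \<odot>\<^bsub>M\<^esub> x = act h \<odot>\<^bsub>M\<^esub> (act k \<odot>\<^bsub>M\<^esub> x)"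
        using xM hk Hc Kc by (simp add: act_mult M.smult_assoc1)
      also have "\<dots> = act h \<odot>\<^bsub>M\<^esub> (scal (\<theta> k) \<odot>\<^bsub>M\<^esub> x)" using x hk by (simp add: isotypic_part_def)
      also have "\<dots> = scal (\<theta> k) \<odot>\<^bsub>M\<^esub> (act h \<odot>\<^bsub>M\<^esub> x)"
        using xM Z by (simp add: A.m_comm flip: M.smult_assoc1)
      also have "\<dots> = scal (\<theta> k) \<odot>\<^bsub>M\<^esub> (scal (\<theta> h) \<odot>\<^bsub>M\<^esub> x)" using x hk by (simp add: isotypic_part_def)
      also have "\<dots> = scal (\<theta> h * \<theta> k) \<odot>\<^bsub>M\<^esub> x"
        using xM Z \<theta>_Z[OF HL[OF hk(1)]] \<theta>_Z[OF KL[OF hk(2)]]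
        by (simp add: scal_mult A.m_comm flip: M.smult_assoc1)
      also have "\<theta> h * \<theta> k = \<theta> (h \<otimes> k)"
        using characters_memD(2)[OF \<theta>, of h k] HL[OF hk(1)] KL[OF hk(2)] by simp
      finally show ?thesis .
    qed
    then show "x \<in> isotypic_part (H <#> K) \<theta>"
      using xM by (auto simp: isotypic_part_def set_mult_def)
  qed
qed

end

section \<open>The action of a cyclic subgroup\<close>

lemma (in abelian_group) minus_eq_zero_iff:
  assumes "x \<in> carrier G" "y \<in> carrier G"
  shows "x \<ominus> y = \<zero> \<longleftrightarrow> x = y"
  using add.inv_solve_right[of \<zero> x y] assms by (auto simp: minus_eq)

locale cyclic_subgroup_action = group_ring_module G R M \<iota> e \<zeta>
  for G :: "('g, 'x) monoid_scheme" (structure) and R :: "('r, 'y) ring_scheme"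
    and M :: "('g \<Rightarrow> 'r, 'm, 'z) module_scheme" and \<iota> e \<zeta> +
  fixes K :: "'g set" and \<tau> :: 'g
  assumes K: "subgroup K G" and \<tau>_K: "\<tau> \<in> K" and generate_\<tau>: "generate G {\<tau>} = K"
    and card_K_dvd: "card K dvd e"
begin

abbreviation "GK \<equiv> G\<lparr>carrier := K\<rparr>"

sublocale C: cyclic_group_characters GK \<tau> e \<zeta>
proof -
  interpret GK: comm_group GK using K by (rule G.comm_group_subgroup)
  have "generate GK {\<tau>} = K" using G.generate_consistent[of "{\<tau>}" K] K \<tau>_K generate_\<tau> by simp
  then show "cyclic_group_characters GK \<tau> e \<zeta>"
    using \<tau>_K card_K_dvd root finite_subset[OF subgroup.subset[OF K] finite_G]
    by unfold_locales (auto simp: Coset.order_def)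
qed

sublocale P: poly_evaluation A Z scal "act \<tau>"
  by (rule poly_evaluation_act)

sublocale h: ring_hom_cring "group_ring R GK" A "gr_extend R G K"
  using K by (rule gr_extend_hom)

definition factor :: "nat \<Rightarrow> 'g \<Rightarrow> 'r" where
  "factor j = act \<tau> \<ominus>\<^bsub>A\<^esub> scal (C.z ^ j)"

lemma \<tau>_closed: "\<tau> \<in> carrier G" using subgroup.mem_carrier[OF K \<tau>_K] .

lemma z_power_closed: "C.z ^ j \<in> Z"
  by (auto simp: cyc_root_def intro: int_adjoin_power int_adjoin_closed(1))

lemma factor_closed [simp]: "factor j \<in> carrier A"
  using z_power_closed by (simp add: factor_def)

section \<open>The tail products and \<epsilon> as products of the elements \<tau> - z^j\<close>

lemma finprod_factor_closed [simp]: "(\<Otimes>\<^bsub>A\<^esub>j\<in>J. factor j) \<in> carrier A"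
  by (intro A.finprod_closed) simp

lemma finprod_factor_Un:
  "finite I \<Longrightarrow> finite J \<Longrightarrow> I \<inter> J = {} \<Longrightarrow>
    (\<Otimes>\<^bsub>A\<^esub>j\<in>I \<union> J. factor j) = (\<Otimes>\<^bsub>A\<^esub>j\<in>I. factor j) \<otimes>\<^bsub>A\<^esub> (\<Otimes>\<^bsub>A\<^esub>j\<in>J. factor j)"
  by (intro A.finprod_Un_disjoint) auto

lemma gr_extend_tail_product:
  "gr_extend R G K (tail_product R \<iota> e \<zeta> GK \<tau> k) = (\<Otimes>\<^bsub>A\<^esub>j\<in>{Suc k..<C.m}. factor j)"
proof -
  interpret GK: finite_group_ring GK R using K by (rule finite_group_ring_subgroup)
  let ?f = "\<lambda>j. gr_single R GK \<one>\<^bsub>R\<^esub> \<tau> \<ominus>\<^bsub>GK.A\<^esub> gr_single R GK (\<iota> (C.z ^ j)) \<one>\<^bsub>GK\<^esub>"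
  have cl: "gr_single R GK \<one>\<^bsub>R\<^esub> \<tau> \<in> carrier GK.A" "gr_single R GK (\<iota> (C.z ^ j)) \<one>\<^bsub>GK\<^esub> \<in> carrier GK.A" for j
    using \<iota>_closed[OF z_power_closed] by (auto intro!: GK.single_closed)
  \<comment> \<open>The closed range of \<open>tail_product\<close> becomes the half-open range that
    indexes the chain.\<close>
  have set: "{k + 1..C.m - 1} = {Suc k..<C.m}" using C.m_pos by auto
  have "gr_extend R G K (?f j) = factor j" for j
    using cl gr_extend_single[OF K \<tau>_K] gr_extend_single[OF K subgroup.one_closed[OF K]]
    by (simp add: factor_def act_def scal_def)
  then have comp: "gr_extend R G K \<circ> ?f = factor" by auto
  have "gr_extend R G K (tail_product R \<iota> e \<zeta> GK \<tau> k) =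
      (\<Otimes>\<^bsub>A\<^esub>j\<in>{Suc k..<C.m}. (gr_extend R G K \<circ> ?f) j)"
    unfolding tail_product_def set using cl by (subst h.hom_finprod) auto
  then show ?thesis unfolding comp .
qed

text \<open>This is X^m - 1, split into linear factors over the roots of unity, evaluated at \<tau>,
  and \<tau>^m = 1. It makes the chain of images end in 0.\<close>

lemma finprod_factor_all: "(\<Otimes>\<^bsub>A\<^esub>j\<in>{..<C.m}. factor j) = \<zero>\<^bsub>A\<^esub>"
proof -
  have "(\<Otimes>\<^bsub>A\<^esub>j\<in>{..<C.m}. factor j) = P.eval_at (monom 1 C.m - 1)"
    using P.eval_at_prod_linear[of "{..<C.m}" "\<lambda>j. C.z ^ j"] z_power_closed
    by (simp add: factor_def prod_linear_roots_of_unity[OF C.root_z])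
  also have "monom 1 C.m - 1 = monom 1 C.m + monom (- 1 :: complex) 0"
    by (simp add: monom_0 one_pCons)
  also have "P.eval_at \<dots> = act \<tau> [^]\<^bsub>A\<^esub> C.m \<oplus>\<^bsub>A\<^esub> scal (- 1)"
    using P.Z_one P.Z_minus[OF P.Z_one]
    by (simp add: P.eval_at_add P.Z_polys_monom P.eval_at_monom P.c_one)
  also have "act \<tau> [^]\<^bsub>A\<^esub> C.m = act (\<tau> [^] C.m)" by (simp add: act_pow \<tau>_closed)
  also have "\<tau> [^] C.m = \<one>"
    using C.pow_order_eq_1[OF C.gen_closed] by (simp flip: G.nat_pow_consistent)
  finally show ?thesis
    using P.c_minus[OF P.Z_one] by (simp add: act_one P.c_one A.r_neg)
qed

text \<open>Evaluate \<open>prod_linear_roots_of_unity_omit\<close> at \<tau>: its sum side becomes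
  \<epsilon> once K is listed as the powers \<tau>^a with a < m.\<close>

lemma gr_extend_char_eps:
  assumes \<chi>: "\<chi> \<in> characters e GK" and k: "k < C.m" "\<chi> \<tau> = C.z ^ k"
  shows "gr_extend R G K (char_eps \<iota> GK \<chi>) = scal (C.z ^ k) \<otimes>\<^bsub>A\<^esub> (\<Otimes>\<^bsub>A\<^esub>j\<in>{..<C.m} - {k}. factor j)"
proof -
  have pow: "\<tau> [^]\<^bsub>GK\<^esub> a = \<tau> [^] a" for a :: nat by (simp flip: G.nat_pow_consistent)
  have z1: "C.z ^ C.m = 1" using C.root_z by (simp add: primitive_root_of_unity_def)
  \<comment> \<open>Since z^m = 1, the inverse of z^(k*a) is a power of z with a nonnegative
    exponent and so lies in Z[\<zeta>].\<close>
  have inv: "inverse (\<chi> (\<tau> [^] a)) = C.z ^ (k * (C.m - a))" if "a < C.m" for a :: nat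
  proof (rule inverse_unique)
    have "\<chi> (\<tau> [^] a) = C.z ^ (k * a)"
      using C.character_pow[OF \<chi> e_pos C.gen_closed, of a] by (simp add: pow k power_mult)
    then have "\<chi> (\<tau> [^] a) * C.z ^ (k * (C.m - a)) = C.z ^ (k * C.m)"
      using that by (simp flip: power_add add_mult_distrib2)
    also have "\<dots> = 1" by (metis z1 mult.commute power_mult power_one)
    finally show "\<chi> (\<tau> [^] a) * C.z ^ (k * (C.m - a)) = 1" .
  qed
  have bij: "bij_betw (\<lambda>a::nat. \<tau> [^] a) {..<C.m} K"
    using C.bij_gen_pow by (simp add: pow)
  have eps: "char_eps \<iota> GK \<chi> (\<tau> [^] a) = \<iota> (C.z ^ (k * (C.m - a)))" if "a < C.m" for a
    using that bij inv by (auto simp: char_eps_def bij_betw_def)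
  have eps_R: "char_eps \<iota> GK \<chi> \<sigma> \<in> carrier R" if "\<sigma> \<in> K" for \<sigma>
  proof -
    have "\<sigma> \<in> (\<lambda>a::nat. \<tau> [^] a) ` {..<C.m}" using bij that by (simp add: bij_betw_def)
    then obtain a :: nat where "a < C.m" "\<sigma> = \<tau> [^] a" by blast
    then show ?thesis using eps \<iota>_closed[OF z_power_closed] by simp
  qed
  have "gr_extend R G K (char_eps \<iota> GK \<chi>) = (\<Oplus>\<^bsub>A\<^esub>\<sigma>\<in>K. gr_single R G (char_eps \<iota> GK \<chi> \<sigma>) \<sigma>)"
    using eps_R by (intro gr_extend_eq_finsum subgroup.subset[OF K])
  also have "\<dots> = (\<Oplus>\<^bsub>A\<^esub>\<sigma>\<in>(\<lambda>a. \<tau> [^] a) ` {..<C.m}. gr_single R G (char_eps \<iota> GK \<chi> \<sigma>) \<sigma>)"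
    using bij by (simp add: bij_betw_def)
  also have "\<dots> = (\<Oplus>\<^bsub>A\<^esub>a\<in>{..<C.m}. gr_single R G (char_eps \<iota> GK \<chi> (\<tau> [^] a)) (\<tau> [^] a))"
    using bij eps_R by (intro A.finsum_reindex) (auto simp: bij_betw_def)
  also have "\<dots> = (\<Oplus>\<^bsub>A\<^esub>a\<in>{..<C.m}. P.eval_at (monom (C.z ^ (k * (C.m - a))) a))"
    using z_power_closed
    by (intro A.finsum_cong')
      (simp_all add: eps scal_act \<tau>_closed P.eval_at_monom act_pow)
  also have "\<dots> = P.eval_at (\<Sum>a<C.m. monom (C.z ^ (k * (C.m - a))) a)"
    using z_power_closed by (intro P.eval_at_sum[symmetric] P.Z_polys_monom)
  also have "\<dots> = scal (C.z ^ k) \<otimes>\<^bsub>A\<^esub> P.eval_at (\<Prod>j\<in>{..<C.m} - {k}. [:- (C.z ^ j), 1:])"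
    using z_power_closed
    by (simp add: P.eval_at_smult P.Z_polys_prod_linear flip: prod_linear_roots_of_unity_omit[OF C.root_z k(1)])
  also have "P.eval_at (\<Prod>j\<in>{..<C.m} - {k}. [:- (C.z ^ j), 1:]) = (\<Otimes>\<^bsub>A\<^esub>j\<in>{..<C.m} - {k}. factor j)"
    using z_power_closed by (simp add: P.eval_at_prod_linear factor_def)
  finally show ?thesis .
qed

text \<open>The element \<tau> - z^k kills x exactly when \<tau> acts on x as \<chi>(\<tau>). As
  \<tau> generates K, induction on powers extends this to all of K.\<close>

lemma isotypic_part_cyclic:
  assumes \<chi>: "\<chi> \<in> characters e GK" and k: "\<chi> \<tau> = C.z ^ k" and x: "x \<in> carrier M"
  shows "x \<in> isotypic_part K \<chi> \<longleftrightarrow> factor k \<odot>\<^bsub>M\<^esub> x = \<zero>\<^bsub>M\<^esub>"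
proof -
  let ?w = "C.z ^ k"
  note [simp] = scal_closed[OF z_power_closed]
  have "factor k \<odot>\<^bsub>M\<^esub> x = act \<tau> \<odot>\<^bsub>M\<^esub> x \<ominus>\<^bsub>M\<^esub> scal ?w \<odot>\<^bsub>M\<^esub> x"
    using x by (simp add: factor_def A.minus_eq M.minus_eq M.smult_l_distr M.smult_l_minus)
  then have "factor k \<odot>\<^bsub>M\<^esub> x = \<zero>\<^bsub>M\<^esub> \<longleftrightarrow> act \<tau> \<odot>\<^bsub>M\<^esub> x = scal ?w \<odot>\<^bsub>M\<^esub> x"
    using x by (simp add: M.minus_eq_zero_iff)
  also have "\<dots> \<longleftrightarrow> x \<in> isotypic_part K \<chi>"
  proof
    assume "x \<in> isotypic_part K \<chi>"
    then show "act \<tau> \<odot>\<^bsub>M\<^esub> x = scal ?w \<odot>\<^bsub>M\<^esub> x" using \<tau>_K k by (simp add: isotypic_part_def)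
  next
    assume eq: "act \<tau> \<odot>\<^bsub>M\<^esub> x = scal ?w \<odot>\<^bsub>M\<^esub> x"
    have pow: "act (\<tau> [^] a) \<odot>\<^bsub>M\<^esub> x = scal (?w ^ a) \<odot>\<^bsub>M\<^esub> x" for a :: nat
    proof (induction a)
      case 0
      then show ?case by (simp add: act_one scal_one)
    next
      case (Suc a)
      have wa: "scal (?w ^ a) \<in> carrier A" using z_power_closed[of "k * a"] by (simp add: power_mult)
      have "act (\<tau> [^] Suc a) \<odot>\<^bsub>M\<^esub> x = act (\<tau> [^] a) \<odot>\<^bsub>M\<^esub> (act \<tau> \<odot>\<^bsub>M\<^esub> x)"
        using x by (simp add: act_mult \<tau>_closed M.smult_assoc1)
      also have "\<dots> = scal ?w \<odot>\<^bsub>M\<^esub> (act (\<tau> [^] a) \<odot>\<^bsub>M\<^esub> x)"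
        using x by (simp add: eq A.m_comm flip: M.smult_assoc1)
      also have "\<dots> = scal (?w ^ Suc a) \<odot>\<^bsub>M\<^esub> x"
        using x wa z_power_closed[of k] z_power_closed[of "k * a"]
        by (simp add: Suc.IH scal_mult power_mult M.smult_assoc1)
      finally show ?case .
    qed
    show "x \<in> isotypic_part K \<chi>"
      unfolding isotypic_part_def
    proof (intro CollectI conjI ballI x)
      fix \<sigma> assume "\<sigma> \<in> K"
      then obtain a :: nat where a: "\<sigma> = \<tau> [^]\<^bsub>GK\<^esub> a" using C.carrier_gen_powE[of \<sigma>] by auto
      then have "\<chi> \<sigma> = ?w ^ a" using C.character_pow[OF \<chi> e_pos C.gen_closed, of a] k by simp
      moreover have "\<sigma> = \<tau> [^] a" using a by (simp flip: G.nat_pow_consistent)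
      ultimately show "act \<sigma> \<odot>\<^bsub>M\<^esub> x = scal (\<chi> \<sigma>) \<odot>\<^bsub>M\<^esub> x" using pow by simp
    qed
  qed
  finally show ?thesis ..
qed

section \<open>The identity for one cyclic factor K acting on the \<psi>-part of M\<close>

context
  fixes H :: "'g set" and \<psi> :: "'g \<Rightarrow> complex"
  assumes H: "subgroup H G" and \<psi>: "\<psi> \<in> characters e (G\<lparr>carrier := H\<rparr>)"
begin

abbreviation "N \<equiv> isotypic_module R \<iota> G H \<psi> K M"
abbreviation "N0 \<equiv> isotypic_part H \<psi>"

text \<open>Passes from the R[K]-module of the definitions to subsets of M with scalars in R[G],
  where the counting lemmas apply.\<close>

lemma N_facts:
  "carrier N = N0" "a \<odot>\<^bsub>N\<^esub> x = gr_extend R G K a \<odot>\<^bsub>M\<^esub> x"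
  "add_monoid (N\<lparr>carrier := Y\<rparr>) = add_monoid M\<lparr>carrier := Y\<rparr>"
  using isotypic_gr_restrict[OF H] by (simp_all add: isotypic_module_def gr_restrict_def gr_extend_def)

lemma N0_submodule: "submodule N0 A M"
  using isotypic_part_submodule[OF H \<psi>] .

lemma N0_subgroup: "subgroup N0 (add_monoid M)"
  using submodule.axioms(1)[OF N0_submodule] .

lemma smult_image_subset_N0: "a \<in> carrier A \<Longrightarrow> (\<lambda>x. a \<odot>\<^bsub>M\<^esub> x) ` N0 \<subseteq> N0"
  using submodule.smult_closed[OF N0_submodule] by auto

text \<open>The submodules form a chain E \<subseteq> S \<subseteq> Y, where Y is the \<chi>-part, E
  the image of \<epsilon> and S the numerator of the S-part. \<open>order_Mod_Mod\<close> then gives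
  the order as [Y]/[S], and S is the kernel occurring in the chain of images.\<close>

lemma order_tate_Mod_S_sub:
  assumes \<chi>: "\<chi> \<in> characters e GK"
  defines "k \<equiv> char_index e \<zeta> GK \<tau> \<chi>"
  shows "Coset.order (tate_H0 R \<iota> GK \<chi> N Mod S_sub R \<iota> e \<zeta> GK \<tau> \<chi> N) *
      card {x \<in> (\<lambda>x. (\<Otimes>\<^bsub>A\<^esub>j\<in>{Suc k..<C.m}. factor j) \<odot>\<^bsub>M\<^esub> x) ` N0. factor k \<odot>\<^bsub>M\<^esub> x = \<zero>\<^bsub>M\<^esub>}
    = card (N0 \<inter> isotypic_part K \<chi>)"
proof -
  have k: "k < C.m" "\<chi> \<tau> = C.z ^ k" using C.char_index[OF \<chi>] by (simp_all add: k_def)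
  let ?T = "\<Otimes>\<^bsub>A\<^esub>j\<in>{Suc k..<C.m}. factor j" and ?B = "\<Otimes>\<^bsub>A\<^esub>j\<in>{..<k}. factor j"
  let ?eps = "scal (C.z ^ k) \<otimes>\<^bsub>A\<^esub> (\<Otimes>\<^bsub>A\<^esub>j\<in>{..<C.m} - {k}. factor j)"
  define Y where "Y = N0 \<inter> isotypic_part K \<chi>"
  define S where "S = Y \<inter> (\<lambda>x. ?T \<odot>\<^bsub>M\<^esub> x) ` N0"
  define E where "E = (\<lambda>x. ?eps \<odot>\<^bsub>M\<^esub> x) ` N0"
  have s: "scal (C.z ^ k) \<in> carrier A" using z_power_closed by simp
  have N0_M: "N0 \<subseteq> carrier M" by (auto simp: isotypic_part_def)
  \<comment> \<open>\<epsilon> is a multiple of the tail product, so its image lies in the image of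
    the tail product.\<close>
  have eps_eq: "?eps = ?T \<otimes>\<^bsub>A\<^esub> (scal (C.z ^ k) \<otimes>\<^bsub>A\<^esub> ?B)"
  proof -
    have split: "{..<C.m} - {k} = {..<k} \<union> {Suc k..<C.m}" using k by auto
    have "(\<Otimes>\<^bsub>A\<^esub>j\<in>{..<C.m} - {k}. factor j) = ?B \<otimes>\<^bsub>A\<^esub> ?T"
      unfolding split by (rule finprod_factor_Un) auto
    then show ?thesis using s by (simp add: A.m_ac)
  qed
  \<comment> \<open>Restoring the omitted factor gives the full product, which is 0; hence \<tau> -
    z^k kills the image of \<epsilon>, which thus lies in the \<chi>-part.\<close>
  have "factor k \<otimes>\<^bsub>A\<^esub> (\<Otimes>\<^bsub>A\<^esub>j\<in>{..<C.m} - {k}. factor j) = \<zero>\<^bsub>A\<^esub>"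
  proof -
    have "{k} \<union> ({..<C.m} - {k}) = {..<C.m}" using k by auto
    then show ?thesis
      using finprod_factor_Un[of "{k}" "{..<C.m} - {k}"] finprod_factor_all by simp
  qed
  then have null: "factor k \<otimes>\<^bsub>A\<^esub> ?eps = \<zero>\<^bsub>A\<^esub>"
    using s by (subst A.m_lcomm) simp_all
  have Y_eq: "Y = {x \<in> N0. factor k \<odot>\<^bsub>M\<^esub> x = \<zero>\<^bsub>M\<^esub>}"
    using isotypic_part_cyclic[OF \<chi> k(2)] N0_M by (auto simp: Y_def)
  \<comment> \<open>The image of the tail product stays inside \<open>N0\<close>, so intersecting it
    with \<open>Y\<close> only imposes the kernel condition.\<close>
  have S_eq: "S = {x \<in> (\<lambda>x. ?T \<odot>\<^bsub>M\<^esub> x) ` N0. factor k \<odot>\<^bsub>M\<^esub> x = \<zero>\<^bsub>M\<^esub>}"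
    using smult_image_subset_N0[of ?T] by (auto simp: S_def Y_eq)
  have ES: "E \<subseteq> S"
  proof
    fix y assume "y \<in> E"
    then obtain x where x: "x \<in> N0" "y = ?eps \<odot>\<^bsub>M\<^esub> x" by (auto simp: E_def)
    have xM: "x \<in> carrier M" using x N0_M by auto
    have "(scal (C.z ^ k) \<otimes>\<^bsub>A\<^esub> ?B) \<odot>\<^bsub>M\<^esub> x \<in> N0"
      using submodule.smult_closed[OF N0_submodule _ x(1)] s by simp
    moreover have "y = ?T \<odot>\<^bsub>M\<^esub> ((scal (C.z ^ k) \<otimes>\<^bsub>A\<^esub> ?B) \<odot>\<^bsub>M\<^esub> x)"
      unfolding x(2) eps_eq using s xM by (intro M.smult_assoc1) auto
    moreover have "factor k \<odot>\<^bsub>M\<^esub> y = \<zero>\<^bsub>M\<^esub>"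
      unfolding x(2) using s xM null by (simp flip: M.smult_assoc1)
    ultimately show "y \<in> S" unfolding S_eq by blast
  qed
  have Y_sub: "subgroup Y (add_monoid M)"
    unfolding Y_def using K isotypic_part_submodule[OF K \<chi>] N0_subgroup
    by (intro group.subgroups_Inter_pair M.a_group) (auto dest: submodule.axioms(1))
  have T_sub: "subgroup ((\<lambda>x. ?T \<odot>\<^bsub>M\<^esub> x) ` N0) (add_monoid M)"
    by (rule M.subgroup_smult_image[OF finprod_factor_closed N0_subgroup])
  have S_sub: "subgroup S (add_monoid M)"
    unfolding S_def by (rule group.subgroups_Inter_pair[OF M.a_group Y_sub T_sub])
  have E_sub: "subgroup E (add_monoid M)"
    unfolding E_def using s by (intro M.subgroup_smult_image N0_subgroup) simp
  have SX: "S \<subseteq> Y" by (simp add: S_def)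
  interpret Y: comm_group "add_monoid M\<lparr>carrier := Y\<rparr>"
    by (rule comm_group.comm_group_subgroup[OF M.a_comm_group Y_sub])
  have iso: "isotypic R \<iota> GK \<chi> N = Y" using isotypic_isotypic_module[OF H K] by (simp add: Y_def)
  have E: "smult_image (char_eps \<iota> GK \<chi>) N = E"
    by (simp add: smult_image_def N_facts gr_extend_char_eps[OF \<chi> k] E_def)
  have T: "smult_image (tail_product R \<iota> e \<zeta> GK \<tau> k) N = (\<lambda>x. ?T \<odot>\<^bsub>M\<^esub> x) ` N0"
    by (simp add: smult_image_def N_facts gr_extend_tail_product)
  have "Coset.order ((add_monoid M\<lparr>carrier := Y\<rparr> Mod E) Mod
        carrier (add_monoid M\<lparr>carrier := Y\<rparr>\<lparr>carrier := S\<rparr> Mod E)) * card S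
      = Coset.order (add_monoid M\<lparr>carrier := Y\<rparr>)"
  proof (rule Y.order_Mod_Mod)
    show "subgroup S (add_monoid M\<lparr>carrier := Y\<rparr>)"
      by (rule group.subgroup_incl[OF M.a_group S_sub Y_sub SX])
    show "subgroup E (add_monoid M\<lparr>carrier := Y\<rparr>)"
      by (rule group.subgroup_incl[OF M.a_group E_sub Y_sub]) (use ES SX in blast)
  qed (rule ES)
  moreover have "Coset.order (add_monoid M\<lparr>carrier := Y\<rparr>) = card Y" by (simp add: Coset.order_def)
  ultimately show ?thesis
    unfolding tate_H0_def S_sub_def iso E N_facts(3) k_def[symmetric] T
      S_def[symmetric] S_eq[symmetric] Y_def[symmetric]
    by simp
qed

text \<open>The orders of the kernels in the chain multiply to [N0]. Reindexed by characters, they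
  are the cofactors in \<open>order_tate_Mod_S_sub\<close>, whose product over \<chi> is the
  claim.\<close>

lemma card_isotypic_part_cyclic_step:
  "card N0 * (\<Prod>\<chi>\<in>characters e GK.
      Coset.order (tate_H0 R \<iota> GK \<chi> N Mod S_sub R \<iota> e \<zeta> GK \<tau> \<chi> N))
    = (\<Prod>\<chi>\<in>characters e GK. card (N0 \<inter> isotypic_part K \<chi>))"
proof -
  let ?c = "\<lambda>k. card {x \<in> (\<lambda>x. (\<Otimes>\<^bsub>A\<^esub>j\<in>{Suc k..<C.m}. factor j) \<odot>\<^bsub>M\<^esub> x) ` N0. factor k \<odot>\<^bsub>M\<^esub> x = \<zero>\<^bsub>M\<^esub>}"
  have "N0 \<subseteq> carrier M" by (auto simp: isotypic_part_def)
  then have "card N0 = (\<Prod>k<C.m. ?c k)"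
    using finprod_factor_all finite_M finite_subset
    by (intro M.card_submodule_eq_prod_annihilated N0_subgroup) auto
  also have "\<dots> = (\<Prod>\<chi>\<in>characters e GK. ?c (char_index e \<zeta> GK \<tau> \<chi>))"
    by (rule prod.reindex_bij_betw[OF C.bij_char_index, symmetric])
  finally show ?thesis
    by (simp add: order_tate_Mod_S_sub mult.commute flip: prod.distrib)
qed

end

end

section \<open>Direct products of cyclic subgroups\<close>

text \<open>The order of the group witnesses that the least number in the definition exists.\<close>

lemma (in group) group_exponent:
  assumes "finite (carrier G)"
  shows "group_exponent G > 0" "\<And>x. x \<in> carrier G \<Longrightarrow> x [^] group_exponent G = \<one>"
proof -
  have "Coset.order G > 0 \<and> (\<forall>x\<in>carrier G. x [^] Coset.order G = \<one>)"
    using assms pow_order_eq_1 order_gt_0_iff_finite by auto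
  then have "group_exponent G > 0 \<and> (\<forall>x\<in>carrier G. x [^] group_exponent G = \<one>)"
    unfolding group_exponent_def by (rule LeastI)
  then show "group_exponent G > 0" "\<And>x. x \<in> carrier G \<Longrightarrow> x [^] group_exponent G = \<one>" by auto
qed

section \<open>Partial products of the cyclic factors\<close>

lemma (in comm_group) partial_product_0: "partial_product G K 0 = {\<one>}"
  by (simp add: partial_product_def)

lemma (in comm_group) partial_product_Suc:
  assumes K: "\<And>j. 1 \<le> j \<Longrightarrow> j \<le> Suc i \<Longrightarrow> K j \<subseteq> carrier G"
  shows "partial_product G K (Suc i) = partial_product G K i <#> K (Suc i)"
proof -
  have split: "{1..Suc i} = insert (Suc i) {1..i}" by auto
  \<comment> \<open>Since \<open>g\<close> only has to agree with \<open>f\<close> up to i, this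
    covers both restricting a family to the first i indices and extending one by a new last
    entry.\<close>
  have fp: "finprod G f {1..Suc i} = finprod G g {1..i} \<otimes> f (Suc i)"
    if "\<And>j. 1 \<le> j \<Longrightarrow> j \<le> Suc i \<Longrightarrow> f j \<in> K j" "\<And>j. 1 \<le> j \<Longrightarrow> j \<le> i \<Longrightarrow> g j = f j" for f g
  proof -
    have f: "f \<in> {1..i} \<rightarrow> carrier G" "f (Suc i) \<in> carrier G" using that(1) K by force+
    have "finprod G f {1..Suc i} = f (Suc i) \<otimes> finprod G f {1..i}"
      unfolding split using f by (intro finprod_insert) auto
    also have "finprod G f {1..i} = finprod G g {1..i}"
      using f(1) that(2) by (intro finprod_cong') auto
    finally show ?thesis using f that(2) by (simp add: m_comm Pi_def)
  qed
  show ?thesis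
  proof (intro equalityI subsetI)
    fix x assume "x \<in> partial_product G K (Suc i)"
    then obtain f where f: "f \<in> Pi\<^sub>E {1..Suc i} K" "x = finprod G f {1..Suc i}"
      by (auto simp: partial_product_def)
    have "x = finprod G (restrict f {1..i}) {1..i} \<otimes> f (Suc i)"
      unfolding f(2) using f(1) by (intro fp) auto
    moreover have "restrict f {1..i} \<in> Pi\<^sub>E {1..i} K" "f (Suc i) \<in> K (Suc i)" using f(1) by auto
    ultimately show "x \<in> partial_product G K i <#> K (Suc i)"
      unfolding partial_product_def set_mult_def by blast
  next
    fix x assume "x \<in> partial_product G K i <#> K (Suc i)"
    then obtain g k where g: "g \<in> Pi\<^sub>E {1..i} K" "k \<in> K (Suc i)" "x = finprod G g {1..i} \<otimes> k"
      by (auto simp: partial_product_def set_mult_def)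
    let ?f = "g(Suc i := k)"
    have f: "?f \<in> Pi\<^sub>E {1..Suc i} K" unfolding split using g(1,2) by (rule PiE_fun_upd[rotated])
    have "finprod G ?f {1..Suc i} = finprod G g {1..i} \<otimes> ?f (Suc i)"
    proof (rule fp)
      show "?f j \<in> K j" if "1 \<le> j" "j \<le> Suc i" for j using PiE_mem[OF f, of j] that by simp
    qed simp
    then have "x = finprod G ?f {1..Suc i}" using g(3) by simp
    with f show "x \<in> partial_product G K (Suc i)" unfolding partial_product_def by blast
  qed
qed

lemma (in comm_group) partial_product_subgroup:
  "(\<And>j. 1 \<le> j \<Longrightarrow> j \<le> i \<Longrightarrow> subgroup (K j) G) \<Longrightarrow> subgroup (partial_product G K i) G"
proof (induction i)
  case 0
  then show ?case using triv_subgroup by (simp add: partial_product_0)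
next
  case (Suc i)
  have "partial_product G K (Suc i) = partial_product G K i <#> K (Suc i)"
    by (intro partial_product_Suc subgroup.subset Suc.prems)
  then show ?case using mult_subgroups[of "partial_product G K i" "K (Suc i)"] Suc by simp
qed

text \<open>A common element x is the product of two families: \<open>F\<close>, its coordinates up
  to i filled up with 1, and \<open>F'\<close>, with x at index i+1 and 1 elsewhere. Injectivity
  makes them equal, and the entry at i+1 gives 1 = x.\<close>

lemma (in comm_group) partial_product_Int:
  assumes K: "\<And>j. 1 \<le> j \<Longrightarrow> j \<le> r \<Longrightarrow> subgroup (K j) G"
    and inj: "inj_on (\<lambda>k. finprod G k {1..r}) (Pi\<^sub>E {1..r} K)" and i: "Suc i \<le> r"
  shows "partial_product G K i \<inter> K (Suc i) = {\<one>}"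
proof (intro equalityI subsetI)
  fix x assume x: "x \<in> partial_product G K i \<inter> K (Suc i)"
  then obtain f where f: "f \<in> Pi\<^sub>E {1..i} K" "x = finprod G f {1..i}" by (auto simp: partial_product_def)
  have Kc: "y \<in> carrier G" if "y \<in> K j" "1 \<le> j" "j \<le> r" for y j
    using subgroup.mem_carrier[OF K] that by blast
  have one: "\<one> \<in> K j" if "1 \<le> j" "j \<le> r" for j using subgroup.one_closed[OF K] that by blast
  define F where "F = (\<lambda>j\<in>{1..r}. if j \<le> i then f j else \<one>)"
  define F' where "F' = (\<lambda>j\<in>{1..r}. if j = Suc i then x else \<one>)"
  have FK: "F \<in> Pi\<^sub>E {1..r} K" "F' \<in> Pi\<^sub>E {1..r} K" using f(1) x one i by (auto simp: F_def F'_def)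
  have "finprod G F {1..r} = finprod G f {1..i}"
  proof (rule finprod_mono_neutral_cong_right)
    show "F \<in> {1..r} \<rightarrow> carrier G" using FK(1) Kc by (auto dest!: PiE_mem)
  qed (use i in \<open>auto simp: F_def\<close>)
  moreover have "finprod G F' {1..r} = (\<Otimes>j\<in>{1..r}. if Suc i = j then x else \<one>)"
    using x Kc[of x "Suc i"] i by (intro finprod_cong') (auto simp: F'_def)
  then have "finprod G F' {1..r} = x"
    using x Kc[of x "Suc i"] i by (simp add: finprod_singleton)
  ultimately have "F = F'" using inj_onD[OF inj _ FK] f(2) by simp
  then have "F (Suc i) = F' (Suc i)" by simp
  then show "x \<in> {\<one>}" using i by (simp add: F_def F'_def)
next
  fix x assume "x \<in> {\<one>}"
  moreover have "\<one> \<in> partial_product G K i" "\<one> \<in> K (Suc i)"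
    using partial_product_subgroup[of i K] K i by (auto intro!: subgroup.one_closed)
  ultimately show "x \<in> partial_product G K i \<inter> K (Suc i)" by simp
qed

lemma (in group) characters_trivial_subgroup:
  assumes "e > 0"
  shows "characters e (G\<lparr>carrier := {\<one>}\<rparr>) = {\<lambda>x\<in>{\<one>}. 1}"
proof -
  interpret T: group "G\<lparr>carrier := {\<one>}\<rparr>" using triv_subgroup by (rule subgroup_imp_group)
  have "\<chi> = (\<lambda>x\<in>{\<one>}. 1)" if "\<chi> \<in> characters e (G\<lparr>carrier := {\<one>}\<rparr>)" for \<chi>
    using characters_memD(3)[OF that] T.character_one[OF that assms]
    by (intro extensionalityI[of _ "{\<one>}"]) auto
  moreover have "(\<lambda>x\<in>{\<one>}. 1) \<in> characters e (G\<lparr>carrier := {\<one>}\<rparr>)"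
    by (rule charactersI) auto
  ultimately show ?thesis by blast
qed

lemma (in group_ring_module) isotypic_part_trivial_subgroup:
  "\<chi> \<one> = 1 \<Longrightarrow> isotypic_part {\<one>} \<chi> = carrier M"
  by (simp add: isotypic_part_def act_one scal_one)

section \<open>Telescoping over the cyclic factors\<close>

theorem theorem3p1:
  fixes G :: "('g, 'x) monoid_scheme"
    and R :: "('r, 'y) ring_scheme"
    and M :: "('g \<Rightarrow> 'r, 'm, 'z) module_scheme"
    and \<iota> :: "complex \<Rightarrow> 'r"
    and \<zeta> :: complex
    and e r :: nat
    and K :: "nat \<Rightarrow> 'g set"
    and \<tau> :: "nat \<Rightarrow> 'g"
  assumes "comm_group G" and "finite (carrier G)" and "e = group_exponent G"
    and "primitive_root_of_unity e \<zeta>"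
    and "cring R" and "\<iota> \<in> ring_hom (int_adjoin \<zeta>) R"
    and "module (group_ring R G) M" and "finite (carrier M)"
    and "1 \<le> r"
    and "\<forall>i\<in>{1..r}. subgroup (K i) G"
    and "\<forall>i\<in>{1..r}. \<tau> i \<in> K i \<and> generate G {\<tau> i} = K i"
    and "(\<lambda>k. finprod G k {1..r}) \<in> iso (product_group {1..r} (\<lambda>i. G\<lparr>carrier := K i\<rparr>)) G"
  shows "card (carrier M) *
      (\<Prod>i=1..r. \<Prod>\<chi>\<in>characters e (G\<lparr>carrier := K i\<rparr>).
        \<Prod>\<psi>\<in>characters e (G\<lparr>carrier := partial_product G K (i - 1)\<rparr>).
          let N = isotypic_module R \<iota> G (partial_product G K (i - 1)) \<psi> (K i) M
          in Coset.order (tate_H0 R \<iota> (G\<lparr>carrier := K i\<rparr>) \<chi> N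
                    Mod S_sub R \<iota> e \<zeta> (G\<lparr>carrier := K i\<rparr>) (\<tau> i) \<chi> N))
    = (\<Prod>\<chi>\<in>characters e G. card (isotypic R \<iota> G \<chi> M))"
proof -
  interpret group_ring_module G R M \<iota> e \<zeta>
    using assms(1,2,4-8)
    by (simp add: group_ring_module_def finite_group_ring_def finite_group_ring_axioms_def
        group_ring_module_axioms_def)
  let ?P = "partial_product G K"
  let ?chars = "\<lambda>H. characters e (G\<lparr>carrier := H\<rparr>)"
  let ?ord = "\<lambda>i \<chi> \<psi>. Coset.order
    (tate_H0 R \<iota> (G\<lparr>carrier := K i\<rparr>) \<chi> (isotypic_module R \<iota> G (?P (i - 1)) \<psi> (K i) M)
      Mod S_sub R \<iota> e \<zeta> (G\<lparr>carrier := K i\<rparr>) (\<tau> i) \<chi> (isotypic_module R \<iota> G (?P (i - 1)) \<psi> (K i) M))"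
  have K_subgroup: "subgroup (K j) G" if "1 \<le> j" "j \<le> r" for j using assms(10) that by simp
  have P: "subgroup (?P i) G" if "i \<le> r" for i
    by (rule G.partial_product_subgroup) (use that in \<open>auto intro!: K_subgroup\<close>)
  have cyclic: "cyclic_subgroup_action G R M \<iota> e \<zeta> (K i) (\<tau> i)" if "1 \<le> i" "i \<le> r" for i
  proof (intro cyclic_subgroup_action.intro cyclic_subgroup_action_axioms.intro group_ring_module_axioms)
    show "subgroup (K i) G" "\<tau> i \<in> K i" "generate G {\<tau> i} = K i" using assms(10,11) that by auto
    then have "\<tau> i \<in> carrier G" by (auto intro: subgroup.mem_carrier)
    \<comment> \<open>The order of K_i is the order of \<tau>_i, which divides the exponent of
      G.\<close>
    then show "card (K i) dvd e"
      using G.group_exponent(2)[OF finite_G] G.generate_pow_card[of "\<tau> i"] G.pow_eq_id[of "\<tau> i" e]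
        \<open>generate G {\<tau> i} = K i\<close> assms(3) by simp
  qed
  \<comment> \<open>The direct decomposition enters through this bijection: injectivity makes G_i
    and K_(i+1) meet trivially, surjectivity gives G_r = G.\<close>
  have bij: "bij_betw (\<lambda>k. finprod G k {1..r}) (Pi\<^sub>E {1..r} K) (carrier G)"
    using assms(12) by (simp add: iso_def)
  have telescope: "card (carrier M) * (\<Prod>l=1..i. \<Prod>\<chi>\<in>?chars (K l). \<Prod>\<psi>\<in>?chars (?P (l - 1)). ?ord l \<chi> \<psi>)
      = (\<Prod>\<theta>\<in>?chars (?P i). card (isotypic_part (?P i) \<theta>))" if "i \<le> r" for i
    using that
  proof (induction i)
    case 0
    \<comment> \<open>G_0 has only the trivial character, whose isotypic part is all of M.\<close>
    show ?case
      by (simp add: G.partial_product_0 G.characters_trivial_subgroup e_pos isotypic_part_trivial_subgroup)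
  next
    case (Suc i)
    let ?H = "?P i" and ?K = "K (Suc i)"
    interpret cyclic_subgroup_action G R M \<iota> e \<zeta> ?K "\<tau> (Suc i)"
      using Suc.prems by (intro cyclic) auto
    have H: "subgroup ?H G" using P Suc.prems by simp
    have HK: "?P (Suc i) = ?H <#>\<^bsub>G\<^esub> ?K"
      using Suc.prems by (intro G.partial_product_Suc subgroup.subset K_subgroup) auto
    have Int: "?H \<inter> ?K = {\<one>\<^bsub>G\<^esub>}"
      using bij Suc.prems by (intro G.partial_product_Int[of r]) (auto simp: bij_betw_def intro!: assms(10)[rule_format])
    have "card (carrier M) * (\<Prod>l=1..Suc i. \<Prod>\<chi>\<in>?chars (K l). \<Prod>\<psi>\<in>?chars (?P (l - 1)). ?ord l \<chi> \<psi>)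
        = (\<Prod>\<psi>\<in>?chars ?H. card (isotypic_part ?H \<psi>)) *
          (\<Prod>\<chi>\<in>?chars ?K. \<Prod>\<psi>\<in>?chars ?H. ?ord (Suc i) \<chi> \<psi>)"
      using Suc.IH Suc.prems by (simp add: prod.nat_ivl_Suc' mult_ac)
    \<comment> \<open>The products over \<chi> and \<psi> are interchanged, so that for each fixed
      \<psi> the identity for one cyclic factor applies to the \<psi>-part.\<close>
    also have "\<dots> = (\<Prod>\<psi>\<in>?chars ?H. card (isotypic_part ?H \<psi>) * (\<Prod>\<chi>\<in>?chars ?K. ?ord (Suc i) \<chi> \<psi>))"
      by (subst prod.swap) (simp add: prod.distrib)
    also have "\<dots> = (\<Prod>\<psi>\<in>?chars ?H. \<Prod>\<chi>\<in>?chars ?K. card (isotypic_part ?H \<psi> \<inter> isotypic_part ?K \<chi>))"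
      using card_isotypic_part_cyclic_step[OF H] by (intro prod.cong refl) simp
    also have "\<dots> = (\<Prod>(\<psi>, \<chi>)\<in>?chars ?H \<times> ?chars ?K. card (isotypic_part ?H \<psi> \<inter> isotypic_part ?K \<chi>))"
      by (rule prod.cartesian_product)
    \<comment> \<open>Pairs (\<psi>, \<chi>) are the restrictions of the characters \<theta> of
      G_(i+1) = G_i K_(i+1), and the intersection of their isotypic parts is the
      \<theta>-part.\<close>
    also have "\<dots> = (\<Prod>\<theta>\<in>?chars (?H <#>\<^bsub>G\<^esub> ?K).
        card (isotypic_part ?H (restrict \<theta> ?H) \<inter> isotypic_part ?K (restrict \<theta> ?K)))"
      by (subst prod.reindex_bij_betw[OF G.bij_characters_internal_product[OF H K Int e_pos], symmetric]) simp
    also have "\<dots> = (\<Prod>\<theta>\<in>?chars (?P (Suc i)). card (isotypic_part (?P (Suc i)) \<theta>))"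
      unfolding HK by (intro prod.cong refl) (simp add: isotypic_part_internal_product[OF H K])
    finally show ?case .
  qed
  have "?P r = carrier G" using bij by (simp add: partial_product_def bij_betw_def)
  then show ?thesis
    using telescope[of r] by (simp add: isotypic_eq_isotypic_part Let_def)
qed

end
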